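(* Let $\bar{\mathbf s}_1,\dots,\bar{\mathbf s}_n$ be $n$ independent sequences of lengths $T_1+1,\dots,T_n+1$, where $\bar{\mathbf s}_i$ is generated by the Brownian bridge model (see context) on $[0,T_i]$, with the same matrix $\mathbf W\in\mathbb R^{d\times d}$ (equivalently, the same $\Sigma=\mathbf W\mathbf W^\top$) for all $i$. Let $\mathbf s_i,\boldsymbol\mu_i\in\mathbb R^{d\times(T_i-1)}$ be the matrices of interior points and of interior means of the $i$-th sequence, and let $\Sigma_{T}\in\mathbb R^{(T-1)\times(T-1)}$ be the covariance matrix (symmetric) with entries $[\Sigma_T]_{s,t}=s(T-t)/T$ for $1\le s\le t\le T-1$. Then the maximum likelihood estimate of $\Sigma$ given $\{\bar{\mathbf s}_i\}_{i=1}^n$ is $$\widehat\Sigma=\Big(\sum_{i=1}^n(T_i-1)\Big)^{-1}\Big(\sum_{i=1}^n(\mathbf s_i-\boldsymbol\mu_i)\Sigma_{T_i}^{-1}(\mathbf s_i-\boldsymbol\mu_i)^\top\Big).$$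
   Context: A standard Brownian bridge on $[0,T]$ is the centered Gaussian process $\{B(t):t\in[0,T]\}$ with $B(0)=B(T)=0$, $B(t)\sim N(0,t(T-t)/T)$, and $\operatorname{Cov}(B(s),B(t))=s(T-t)/T$ for $s<t$. Brownian bridge model on $[0,T]$ with matrix $\mathbf W\in\mathbb R^{d\times d}$: a sequence $\bar{\mathbf s}=(s_0,\dots,s_T)$ with $s_t\in\mathbb R^d$, fixed start point $s_0$ and end point $s_T$, such that at each time $t$ $$s_t=\mu_t+\mathbf W(B_1(t),\dots,B_d(t))^\top,\qquad \mu_t=s_0+\tfrac tT(s_T-s_0),$$ where $B_1,\dots,B_d$ are independent standard Brownian bridges on $[0,T]$. Put $\Sigma=\mathbf W\mathbf W^\top$; it is the only unknown parameter. The interior points and interior means are collected as the $d\times(T-1)$ matrices $\mathbf s=(s_1,\dots,s_{T-1})$ and $\boldsymbol\mu=(\mu_1,\dots,\mu_{T-1})$, whose $t$-th columns are $s_t$ and $\mu_t$. The maximum likelihood estimate refers to the log-likelihood function of $\Sigma$ (start and end points being fixed), which, with $|A|$ denoting the determinant, is $$\ell(\Sigma\mid\{\bar{\mathbf s}_i\}_{i=1}^n)=\frac12\Big(-d\log(2\pi)\sum_{i=1}^n(T_i-1)-d\sum_{i=1}^n\log|\Sigma_{T_i}|-\log|\Sigma|\sum_{i=1}^n(T_i-1)-\sum_{i=1}^n\operatorname{tr}\big(\Sigma^{-1}(\mathbf s_i-\boldsymbol\mu_i)\Sigma_{T_i}^{-1}(\mathbf s_i-\boldsymbol\mu_i)^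\top\big)\Big).$$
   Formalization: Assumes the sum of (T_i−1) is positive; the MLE, over nonsingular Σ, exists iff Σ̂ is invertible and then is Σ̂ (a.s. so if W is invertible and the sum is ≥ d); for singular Σ̂ (e.g. n=1, T=2, d=2) the likelihood is unbounded and no MLE exists. *)

theory Defs
  imports
    "HOL-Probability.Probability"
    "Jordan_Normal_Form.Determinant"
    "Jordan_Normal_Form.Gauss_Jordan_Elimination"
begin

unbundle no vec_syntax

definition mat_trace :: "real mat \<Rightarrow> real" where
  "mat_trace A = (\<Sum>i<dim_row A. A $$ (i, i))"

text \<open>Only meaningful for invertible square matrices; unspecified otherwise.\<close>

definition mat_inv :: "real mat \<Rightarrow> real mat" where
  "mat_inv A = the (mat_inverse A)"

text \<open>The sum of a finite family of matrices of common dimension \<open>d \<times> d\<close>; since matrices of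
  all dimensions share one type, the operator \<open>\<Sum>\<close> does not apply to them directly.\<close>

definition mat_sum :: "nat \<Rightarrow> ('i \<Rightarrow> real mat) \<Rightarrow> 'i set \<Rightarrow> real mat" where
  "mat_sum d A I = mat d d (\<lambda>jk. \<Sum>i\<in>I. A i $$ jk)"

text \<open>Normal laws may be degenerate (variance zero).\<close>

definition normal_rv :: "'w measure \<Rightarrow> ('w \<Rightarrow> real) \<Rightarrow> bool" where
  "normal_rv M X \<longleftrightarrow> X \<in> borel_measurable M \<and>
     (\<exists>m. (AE \<omega> in M. X \<omega> = m) \<or> (\<exists>\<sigma>>0. distributed M lborel X (normal_density m \<sigma>)))"

definition gaussian_process :: "'w measure \<Rightarrow> 't set \<Rightarrow> ('t \<Rightarrow> 'w \<Rightarrow> real) \<Rightarrow> bool" where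
  "gaussian_process M I X \<longleftrightarrow>
     (\<forall>F c. finite F \<and> F \<subseteq> I \<longrightarrow> normal_rv M (\<lambda>\<omega>. \<Sum>t\<in>F. c t * X t \<omega>))"

text \<open>The process is centered, so \<open>E (B s * B t)\<close> is the covariance, and \<open>s = t\<close> gives the
  variance \<open>t (T - t) / T\<close>. Continuity of paths is not required.\<close>

definition standard_brownian_bridge :: "'w measure \<Rightarrow> real \<Rightarrow> (real \<Rightarrow> 'w \<Rightarrow> real) \<Rightarrow> bool" where
  "standard_brownian_bridge M T B \<longleftrightarrow>
     gaussian_process M {0..T} B \<and>
     (\<forall>t\<in>{0..T}. (\<integral>\<omega>. B t \<omega> \<partial>M) = 0) \<and>
     (\<forall>\<omega>\<in>space M. B 0 \<omega> = 0 \<and> B T \<omega> = 0) \<and>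
     (\<forall>s t. 0 \<le> s \<and> s \<le> t \<and> t \<le> T \<longrightarrow> (\<integral>\<omega>. B s \<omega> * B t \<omega> \<partial>M) = s * (T - t) / T)"

definition bridge_mean :: "nat \<Rightarrow> real vec \<Rightarrow> real vec \<Rightarrow> nat \<Rightarrow> real vec" where
  "bridge_mean T a b t = a + (real t / real T) \<cdot>\<^sub>v (b - a)"

text \<open>A random sequence \<open>s 0, \<dots>, s T\<close> in dimension \<open>d\<close> from \<open>a\<close> to \<open>b\<close>. The coordinate bridges
  are independent as processes on \<open>[0, T]\<close>.\<close>

definition brownian_bridge_model ::
  "'w measure \<Rightarrow> nat \<Rightarrow> nat \<Rightarrow> real mat \<Rightarrow> real vec \<Rightarrow> real vec \<Rightarrow> (nat \<Rightarrow> 'w \<Rightarrow> real vec) \<Rightarrow> bool"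
where
  "brownian_bridge_model M d T W a b s \<longleftrightarrow>
     (\<exists>B. (\<forall>k<d. standard_brownian_bridge M (real T) (B k)) \<and>
          prob_space.indep_vars M (\<lambda>k. Pi\<^sub>M {0..real T} (\<lambda>_. borel))
            (\<lambda>k \<omega>. \<lambda>t\<in>{0..real T}. B k t \<omega>) {..<d} \<and>
          (\<forall>t\<le>T. \<forall>\<omega>\<in>space M.
             s t \<omega> = bridge_mean T a b t + W *\<^sub>v vec d (\<lambda>k. B k (real t) \<omega>)))"

text \<open>A family of random sequences in dimension \<open>d\<close>, the \<open>i\<close>-th having times \<open>0, \<dots>, T i\<close>, is
  independent: each sequence is one random element, given by all its coordinates at all times.\<close>

definition indep_sequences ::
  "'w measure \<Rightarrow> nat \<Rightarrow> (nat \<Rightarrow> nat) \<Rightarrow> (nat \<Rightarrow> nat \<Rightarrow> 'w \<Rightarrow> real vec) \<Rightarrow> nat set \<Rightarrow> bool" where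
  "indep_sequences M d T s I \<longleftrightarrow>
     prob_space.indep_vars M (\<lambda>i. Pi\<^sub>M ({0..T i} \<times> {..<d}) (\<lambda>_. borel))
       (\<lambda>i \<omega>. \<lambda>(t, k)\<in>{0..T i} \<times> {..<d}. s i t \<omega> $ k) I"

text \<open>In the following, \<open>x\<close> (or \<open>x i\<close>) is an observed sequence of points \<open>x 0, \<dots>, x T\<close>.\<close>

definition interior_points :: "nat \<Rightarrow> nat \<Rightarrow> (nat \<Rightarrow> real vec) \<Rightarrow> real mat" where
  "interior_points d T x = mat_of_cols d (map x [1..<T])"

definition interior_means :: "nat \<Rightarrow> nat \<Rightarrow> (nat \<Rightarrow> real vec) \<Rightarrow> real mat" where
  "interior_means d T x = mat_of_cols d (map (bridge_mean T (x 0) (x T)) [1..<T])"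

text \<open>Matrix indices start at 0, times at 1.\<close>

definition bridge_cov :: "nat \<Rightarrow> real mat" where
  "bridge_cov T = mat (T - 1) (T - 1) (\<lambda>(i, j).
     let s = real (min i j + 1); t = real (max i j + 1) in s * (real T - t) / real T)"

definition bridge_scatter :: "nat \<Rightarrow> nat \<Rightarrow> (nat \<Rightarrow> real vec) \<Rightarrow> real mat" where
  "bridge_scatter d T x =
     (interior_points d T x - interior_means d T x) * mat_inv (bridge_cov T) *
     transpose_mat (interior_points d T x - interior_means d T x)"

definition log_likelihood ::
  "nat \<Rightarrow> nat \<Rightarrow> (nat \<Rightarrow> nat) \<Rightarrow> (nat \<Rightarrow> nat \<Rightarrow> real vec) \<Rightarrow> real mat \<Rightarrow> real" where
  "log_likelihood d n T x S = 1 / 2 *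
     (- real d * ln (2 * pi) * (\<Sum>i=1..n. real (T i - 1))
      - real d * (\<Sum>i=1..n. ln (Determinant.det (bridge_cov (T i))))
      - ln (Determinant.det S) * (\<Sum>i=1..n. real (T i - 1))
      - (\<Sum>i=1..n. mat_trace (mat_inv S *
          (interior_points d (T i) (x i) - interior_means d (T i) (x i)) *
          mat_inv (bridge_cov (T i)) *
          transpose_mat (interior_points d (T i) (x i) - interior_means d (T i) (x i)))))"

text \<open>The matrices \<open>\<Sigma> = W W\<^sup>T\<close> at which the log-likelihood, involving \<open>\<Sigma>\<^sup>-\<^sup>1\<close> and \<open>log |\<Sigma>|\<close>, is
  defined.\<close>

definition covariance_params :: "nat \<Rightarrow> real mat set" where
  "covariance_params d = {W * transpose_mat W | W. W \<in> carrier_mat d d \<and> invertible_mat W}"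

definition is_mle ::
  "nat \<Rightarrow> nat \<Rightarrow> (nat \<Rightarrow> nat) \<Rightarrow> (nat \<Rightarrow> nat \<Rightarrow> real vec) \<Rightarrow> real mat \<Rightarrow> bool" where
  "is_mle d n T x S \<longleftrightarrow> S \<in> covariance_params d \<and>
     (\<forall>S'\<in>covariance_params d. log_likelihood d n T x S' \<le> log_likelihood d n T x S)"

definition sigma_hat ::
  "nat \<Rightarrow> nat \<Rightarrow> (nat \<Rightarrow> nat) \<Rightarrow> (nat \<Rightarrow> nat \<Rightarrow> real vec) \<Rightarrow> real mat" where
  "sigma_hat d n T x =
     inverse (\<Sum>i=1..n. real (T i - 1)) \<cdot>\<^sub>m mat_sum d (\<lambda>i. bridge_scatter d (T i) (x i)) {1..n}"

end

theory Submission
  imports Defs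
begin

text \<open>Write \<open>A\<close> for \<open>sigma_hat\<close>. Up to an additive constant and a negative factor the log-likelihood is
  \<open>ln |S| + tr (S\<^sup>-\<^sup>1 A)\<close>. For \<open>S = W W\<^sup>T\<close> and invertible \<open>A\<close> it exceeds its value at \<open>A\<close> by
  \<open>tr C - d - ln |C|\<close>, where \<open>C = W\<^sup>-\<^sup>1 A W\<^sup>-\<^sup>T\<close>; a Cholesky factor of \<open>C\<close> and \<open>ln x \<le> x - 1\<close> on its
  squared diagonal entries show that this is nonnegative and vanishes only for \<open>C = 1\<close>. If \<open>A\<close> is singular,
  there is no minimum, since \<open>S\<close> can be shrunk along a kernel vector of \<open>A\<close>.

  Almost sure invertibility needs no density. Each coordinate of the bridges, read over all sequences
  and interior times, is a random row such that every nontrivial fixed linear form in it is almost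
  surely nonzero, and the rows are independent; conditioning on the previous rows, the leading
  minors of \<open>d\<close> selected columns are almost surely nonzero.\<close>

section \<open>Positive definite matrices\<close>

text \<open>The almost sure part has to repair a mismatch in the data. Independence across
  \<open>i\<close> is given for the sequences, independence across coordinates for the bridges
  behind one sequence, and these bridges are obtained separately for each \<open>i\<close>.
  Inverting \<open>W\<close> writes the bridges at integer times as measurable functions of the
  sequence, so that all pairs of a sequence and a coordinate become independent; regrouping them by
  coordinate yields the independent rows. Normality is given only inside one bridge, so a linear
  form in a row is split by sequence: one part is normal with positive variance, hence without
  atoms, and independent of the rest. That variance is positive because the bridge covariance is the
  inverse of \<open>D^T D\<close>, where \<open>D\<close> takes the increments of a path pinned at 0
  at both ends. The same factorisation makes every scatter matrix a Gram matrix, so that a kernel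
  vector of \<open>A\<close> is orthogonal to every interior deviation from the mean.\<close>

lemma cholesky_coefficients:
  fixes C :: "nat \<Rightarrow> nat \<Rightarrow> real"
  assumes "\<And>i j. i < n \<Longrightarrow> j < n \<Longrightarrow> C i j = C j i"
    and "\<And>x. \<exists>i<n. x i \<noteq> 0 \<Longrightarrow> 0 < (\<Sum>i<n. \<Sum>j<n. x i * C i j * x j)"
  shows "\<exists>L. (\<forall>i<n. 0 < L i i) \<and> (\<forall>i j. i < j \<longrightarrow> L i j = 0) \<and>
    (\<forall>i<n. \<forall>j<n. C i j = (\<Sum>k<n. L i k * L j k))"
  using assms
proof (induction n arbitrary: C)
  case 0
  show ?case by (rule exI[of _ "\<lambda>_ _. 0"]) simp
next
  case (Suc n)
  define a where "a = C 0 0"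
  \<comment> \<open>The form at the first unit vector is the pivot.\<close>
  have "0 < (\<Sum>i<Suc n. \<Sum>j<Suc n. (if i = 0 then 1 else 0) * C i j * (if j = 0 then 1 else 0))"
    by (rule Suc.prems(2)) auto
  also have "\<dots> = a"
    by (simp only: sum.lessThan_Suc_shift) (simp add: a_def)
  finally have a: "0 < a" .
  \<comment> \<open>Schur complement of the pivot: what remains of \<open>C\<close> once the outer
    product of the first column of the factor is subtracted.\<close>
  define S where "S i j = C (Suc i) (Suc j) - C (Suc i) 0 * C (Suc j) 0 / a" for i j
  have "\<exists>L. (\<forall>i<n. 0 < L i i) \<and> (\<forall>i j. i < j \<longrightarrow> L i j = 0) \<and>
    (\<forall>i<n. \<forall>j<n. S i j = (\<Sum>k<n. L i k * L j k))"
  proof (rule Suc.IH)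
    show "S i j = S j i" if "i < n" "j < n" for i j
      using Suc.prems(1)[of "Suc i" "Suc j"] that by (simp add: S_def)
  next
    fix x :: "nat \<Rightarrow> real" assume x: "\<exists>i<n. x i \<noteq> 0"
    define b where "b = (\<Sum>j<n. C (Suc j) 0 * x j)"
    define q where "q = (\<Sum>i<n. \<Sum>j<n. x i * C (Suc i) (Suc j) * x j)"
    \<comment> \<open>\<open>- b / a\<close> minimises the form of \<open>C\<close> over the first
      coordinate when the others are \<open>x\<close>; completing the square shows that the minimum
      is the form of \<open>S\<close> at \<open>x\<close>.\<close>
    define y where "y i = (case i of 0 \<Rightarrow> - b / a | Suc j \<Rightarrow> x j)" for i
    from x obtain i where "i < n" "x i \<noteq> 0" by blast
    then have "\<exists>i<Suc n. y i \<noteq> 0"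
      by (intro exI[of _ "Suc i"]) (simp add: y_def)
    then have "0 < (\<Sum>i<Suc n. \<Sum>j<Suc n. y i * C i j * y j)"
      by (rule Suc.prems(2))
    also have "\<dots> = (y 0 * a * y 0 + (\<Sum>j<n. y 0 * C 0 (Suc j) * x j)) +
        ((\<Sum>i<n. x i * C (Suc i) 0 * y 0) + q)"
      by (simp only: sum.lessThan_Suc_shift sum.distrib q_def a_def)
        (simp add: y_def)
    also have "(\<Sum>j<n. y 0 * C 0 (Suc j) * x j) = y 0 * b"
      unfolding b_def sum_distrib_left
      by (intro sum.cong refl) (simp add: Suc.prems(1)[of 0])
    also have "(\<Sum>i<n. x i * C (Suc i) 0 * y 0) = y 0 * b"
      unfolding b_def sum_distrib_left by (intro sum.cong refl) simp
    also have "y 0 * a * y 0 + y 0 * b + (y 0 * b + q) = q - b * b / a"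
      using a by (simp add: y_def field_simps)
    also have "b * b / a = (\<Sum>i<n. \<Sum>j<n. x i * (C (Suc i) 0 * C (Suc j) 0 / a) * x j)"
      unfolding b_def sum_product sum_divide_distrib
      by (intro sum.cong refl) simp
    also have "q - \<dots> = (\<Sum>i<n. \<Sum>j<n. x i * S i j * x j)"
      unfolding q_def S_def sum_subtractf[symmetric]
      by (intro sum.cong refl) (simp add: algebra_simps)
    finally show "0 < (\<Sum>i<n. \<Sum>j<n. x i * S i j * x j)" .
  qed
  then obtain L where "\<forall>i<n. 0 < L i i" "\<forall>i j. i < j \<longrightarrow> L i j = 0"
    "\<forall>i<n. \<forall>j<n. S i j = (\<Sum>k<n. L i k * L j k)"
    by (elim exE conjE)
  note L = this[rule_format]
  \<comment> \<open>The pivot column divided by \<open>sqrt a\<close>, followed by the factor of the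
    Schur complement.\<close>
  define L' where "L' i j = (case i of 0 \<Rightarrow> (case j of 0 \<Rightarrow> sqrt a | Suc _ \<Rightarrow> 0)
    | Suc k \<Rightarrow> (case j of 0 \<Rightarrow> C (Suc k) 0 / sqrt a | Suc l \<Rightarrow> L k l))" for i j
  have "C i j = (\<Sum>k<Suc n. L' i k * L' j k)" if "i < Suc n" "j < Suc n" for i j
  proof -
    have "L' i 0 * L' j 0 + (\<Sum>k<n. L' i (Suc k) * L' j (Suc k)) = C i j"
      using that a L(3)[of "i - 1" "j - 1", symmetric] Suc.prems(1)[of 0 "j"]
      by (cases i; cases j) (auto simp: L'_def S_def a_def)
    then show ?thesis by (simp only: sum.lessThan_Suc_shift)
  qed
  moreover have "0 < L' i i" if "i < Suc n" for i
    using a L(1) that by (cases i) (auto simp: L'_def)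
  moreover have "L' i j = 0" if "i < j" for i j
    using L(2) that by (cases i; cases j) (auto simp: L'_def)
  ultimately show ?case
    by (intro exI[of _ L'] conjI allI impI)
qed

definition positive_definite :: "nat \<Rightarrow> real mat \<Rightarrow> bool" where
  "positive_definite n A \<longleftrightarrow> A \<in> carrier_mat n n \<and> transpose_mat A = A \<and>
     (\<forall>v\<in>carrier_vec n. v \<noteq> 0\<^sub>v n \<longrightarrow> 0 < v \<bullet> (A *\<^sub>v v))"

lemma quadratic_form_sum:
  fixes A :: "real mat"
  assumes "A \<in> carrier_mat n n" "v \<in> carrier_vec n"
  shows "v \<bullet> (A *\<^sub>v v) = (\<Sum>i<n. \<Sum>j<n. v $ i * A $$ (i, j) * v $ j)"
  using assms
  by (auto simp: scalar_prod_def sum_distrib_left mult.assoc lessThan_atLeast0 intro!: sum.cong)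

lemma cholesky:
  assumes "positive_definite n A"
  obtains L where "L \<in> carrier_mat n n" "\<And>i j. i < j \<Longrightarrow> j < n \<Longrightarrow> L $$ (i, j) = 0"
    "\<And>i. i < n \<Longrightarrow> 0 < L $$ (i, i)" "A = L * transpose_mat L"
proof -
  have A: "A \<in> carrier_mat n n" and sym: "transpose_mat A = A"
    and pd: "\<And>v. v \<in> carrier_vec n \<Longrightarrow> v \<noteq> 0\<^sub>v n \<Longrightarrow> 0 < v \<bullet> (A *\<^sub>v v)"
    using assms by (auto simp: positive_definite_def)
  have "\<exists>L. (\<forall>i<n. 0 < L i i) \<and> (\<forall>i j. i < j \<longrightarrow> L i j = 0) \<and>
    (\<forall>i<n. \<forall>j<n. A $$ (i, j) = (\<Sum>k<n. L i k * L j k))"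
  proof (rule cholesky_coefficients)
    show "A $$ (i, j) = A $$ (j, i)" if "i < n" "j < n" for i j
      using arg_cong[OF sym, of "\<lambda>B. B $$ (i, j)"] A that by simp
  next
    fix x :: "nat \<Rightarrow> real" assume "\<exists>i<n. x i \<noteq> 0"
    then have "vec n x \<noteq> 0\<^sub>v n"
      by (metis index_vec index_zero_vec(1))
    then show "0 < (\<Sum>i<n. \<Sum>j<n. x i * A $$ (i, j) * x j)"
      using pd[of "vec n x"] quadratic_form_sum[OF A, of "vec n x"] by simp
  qed
  then obtain L where "\<forall>i<n. 0 < L i i" "\<forall>i j. i < j \<longrightarrow> L i j = 0"
    "\<forall>i<n. \<forall>j<n. A $$ (i, j) = (\<Sum>k<n. L i k * L j k)"
    by (elim exE conjE)
  note L = this[rule_format]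
  show ?thesis
  proof (rule that[of "mat n n (\<lambda>(i, j). L i j)"])
    show "A = mat n n (\<lambda>(i, j). L i j) * transpose_mat (mat n n (\<lambda>(i, j). L i j))"
      using A L(3) by (intro eq_matI) (auto simp: scalar_prod_def lessThan_atLeast0)
  qed (use L in auto)
qed

section \<open>Inverses, determinants and definiteness\<close>

lemma mat_inv_eqI:
  assumes "A \<in> carrier_mat n n" "B \<in> carrier_mat n n" "B * A = 1\<^sub>m n"
  shows "mat_inv A = B"
proof -
  have AB: "A * B = 1\<^sub>m n"
    using mat_mult_left_right_inverse[OF assms(2,1,3)] .
  then have "A \<in> Units (ring_mat TYPE(real) n ())"
    using assms by (auto simp: Units_def ring_mat_def)
  \<comment> \<open>\<open>mat_inverse\<close> is specified through units of the matrix ring. As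
    \<open>A\<close> is one, Gauss-Jordan elimination returns some \<open>C\<close>, and this right
    inverse equals the left inverse \<open>B\<close>.\<close>
  then obtain C where C: "mat_inverse A = Some C"
    using mat_inverse(1)[OF assms(1), where b = "()"] by (cases "mat_inverse A") auto
  then have "A * C = 1\<^sub>m n" "C \<in> carrier_mat n n"
    using mat_inverse(2)[OF assms(1)] by auto
  then have "C = B * A * C" using assms by simp
  also have "\<dots> = B" using assms \<open>A * C = 1\<^sub>m n\<close> \<open>C \<in> carrier_mat n n\<close>
    by (subst assoc_mult_mat[of _ n n _ n _ n]) auto
  finally show ?thesis using C by (simp add: mat_inv_def)
qed

lemma invertible_mat_obtain_inverse:
  fixes A :: "real mat"
  assumes "A \<in> carrier_mat n n" "invertible_mat A"
  obtains B where "B \<in> carrier_mat n n" "A * B = 1\<^sub>m n" "B * A = 1\<^sub>m n"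
proof -
  obtain B where B: "A * B = 1\<^sub>m n" "B * A = 1\<^sub>m (dim_row B)"
    using assms by (auto simp: invertible_mat_def inverts_mat_def)
  \<comment> \<open>\<open>invertible_mat\<close> does not fix the dimensions of \<open>B\<close>;
    they are read off from the two products.\<close>
  have "dim_row B = n" "dim_col B = n"
    using assms(1) arg_cong[OF B(1), of dim_col] arg_cong[OF B(2), of dim_col] by auto
  then show ?thesis using B by (intro that[of B]) auto
qed

lemma invertible_matI:
  fixes A :: "real mat"
  assumes "A \<in> carrier_mat n n" "B \<in> carrier_mat n n" "A * B = 1\<^sub>m n"
  shows "invertible_mat A"
  unfolding invertible_mat_def inverts_mat_def square_mat.simps
  using assms mat_mult_left_right_inverse[OF assms] by (intro conjI exI[of _ B]) auto

lemma invertible_mat_iff_det: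
  fixes A :: "real mat"
  assumes "A \<in> carrier_mat n n"
  shows "invertible_mat A \<longleftrightarrow> Determinant.det A \<noteq> 0"
proof
  assume "invertible_mat A"
  from invertible_mat_obtain_inverse[OF assms this]
  obtain B where "B \<in> carrier_mat n n" "A * B = 1\<^sub>m n" .
  then show "Determinant.det A \<noteq> 0"
    using det_mult[OF assms, of B] by auto
next
  assume "Determinant.det A \<noteq> 0"
  from det_non_zero_imp_unit[OF assms this, where b = "()"]
  obtain B where "B \<in> carrier_mat n n" "A * B = 1\<^sub>m n"
    by (auto simp: Units_def ring_mat_def)
  with assms show "invertible_mat A" by (rule invertible_matI)
qed

lemma invertible_mat_iff_kernel:
  fixes A :: "real mat"
  assumes "A \<in> carrier_mat n n"
  shows "invertible_mat A \<longleftrightarrow> (\<forall>v\<in>carrier_vec n. A *\<^sub>v v = 0\<^sub>v n \<longrightarrow> v = 0\<^sub>v n)"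
  using det_0_iff_vec_prod_zero_field[OF assms] invertible_mat_iff_det[OF assms] by blast

text \<open>For a Cholesky factor \<open>L\<close>, the trace is the sum of all squared entries
  while the determinant sees only the diagonal. The gap therefore splits into terms
  \<open>x - 1 - ln x\<close> for the squared diagonal entries and the squares off the diagonal; in
  the equality case the latter force \<open>L\<close> to be diagonal.\<close>

lemma ln_det_le_trace:
  assumes "positive_definite n C"
  shows "0 < Determinant.det C" "ln (Determinant.det C) \<le> mat_trace C - real n"
    "ln (Determinant.det C) = mat_trace C - real n \<Longrightarrow> C = 1\<^sub>m n"
proof -
  obtain L where L: "L \<in> carrier_mat n n" "\<And>i j. i < j \<Longrightarrow> j < n \<Longrightarrow> L $$ (i, j) = 0"
    "\<And>i. i < n \<Longrightarrow> 0 < L $$ (i, i)" "C = L * transpose_mat L"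
    using cholesky[OF assms] by blast
  have "Determinant.det L = (\<Prod>i<n. L $$ (i, i))"
    using det_lower_triangular[OF L(2,1)] L(1)
    by (simp add: prod_list_diag_prod lessThan_atLeast0)
  then have det: "Determinant.det C = (\<Prod>i<n. (L $$ (i, i))\<^sup>2)"
    using L(1) unfolding L(4)
    by (subst det_mult[of _ n]) (auto simp: det_transpose power2_eq_square prod.distrib)
  have sq_pos: "0 < (L $$ (i, i))\<^sup>2" if "i < n" for i
    using L(3)[OF that] by simp
  show "0 < Determinant.det C"
    unfolding det using sq_pos by (intro prod_pos) blast
  have "ln (Determinant.det C) = (\<Sum>i<n. ln ((L $$ (i, i))\<^sup>2))"
    unfolding det by (intro ln_prod) (auto dest: sq_pos)
  moreover have "mat_trace C = (\<Sum>i<n. \<Sum>k<n. (L $$ (i, k))\<^sup>2)"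
    using L(1) unfolding L(4)
    by (auto simp: mat_trace_def scalar_prod_def power2_eq_square lessThan_atLeast0)
  moreover have "(\<Sum>k<n. (L $$ (i, k))\<^sup>2) =
      (L $$ (i, i))\<^sup>2 + (\<Sum>k\<in>{..<n} - {i}. (L $$ (i, k))\<^sup>2)" if "i < n" for i
    using that by (intro sum.remove) auto
  ultimately have gap: "mat_trace C - real n - ln (Determinant.det C) =
      (\<Sum>i<n. (L $$ (i, i))\<^sup>2 - 1 - ln ((L $$ (i, i))\<^sup>2) + (\<Sum>k\<in>{..<n} - {i}. (L $$ (i, k))\<^sup>2))"
    by (simp add: sum.distrib sum_subtractf)
  have nn1: "0 \<le> (L $$ (i, i))\<^sup>2 - 1 - ln ((L $$ (i, i))\<^sup>2)" if "i < n" for i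
    using ln_le_minus_one[of "(L $$ (i, i))\<^sup>2"] L(3)[OF that] by simp
  have nn2: "0 \<le> (\<Sum>k\<in>{..<n} - {i}. (L $$ (i, k))\<^sup>2)" for i
    by (intro sum_nonneg) simp
  have "0 \<le> mat_trace C - real n - ln (Determinant.det C)"
    unfolding gap by (intro sum_nonneg add_nonneg_nonneg nn1 nn2) simp
  then show "ln (Determinant.det C) \<le> mat_trace C - real n" by simp
  assume "ln (Determinant.det C) = mat_trace C - real n"
  then have "(\<Sum>i<n. (L $$ (i, i))\<^sup>2 - 1 - ln ((L $$ (i, i))\<^sup>2) +
      (\<Sum>k\<in>{..<n} - {i}. (L $$ (i, k))\<^sup>2)) = 0"
    using gap by simp
  then have "\<forall>i\<in>{..<n}. (L $$ (i, i))\<^sup>2 - 1 - ln ((L $$ (i, i))\<^sup>2) +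
      (\<Sum>k\<in>{..<n} - {i}. (L $$ (i, k))\<^sup>2) = 0"
    by (subst (asm) sum_nonneg_eq_0_iff) (auto intro!: add_nonneg_nonneg nn1 nn2)
  then have zero: "(L $$ (i, i))\<^sup>2 - 1 - ln ((L $$ (i, i))\<^sup>2) = 0"
    "(\<Sum>k\<in>{..<n} - {i}. (L $$ (i, k))\<^sup>2) = 0" if "i < n" for i
    using nn1[OF that] nn2[of i] that add_nonneg_eq_0_iff[OF nn1[OF that] nn2[of i]] by blast+
  have diag: "L $$ (i, i) = 1" if "i < n" for i
    using zero(1)[OF that] L(3)[OF that] ln_eq_minus_one[of "(L $$ (i, i))\<^sup>2"]
    by (simp add: power2_eq_1_iff)
  have off: "L $$ (i, k) = 0" if "i < n" "k < n" "k \<noteq> i" for i k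
    using zero(2)[OF that(1)] that by (subst (asm) sum_nonneg_eq_0_iff) auto
  have "L = 1\<^sub>m n"
    using L(1) by (intro eq_matI) (auto simp: diag off)
  then show "C = 1\<^sub>m n" unfolding L(4) by simp
qed

lemma mult_mat_zero_vec:
  fixes A :: "real mat"
  assumes "A \<in> carrier_mat m n"
  shows "A *\<^sub>v 0\<^sub>v n = 0\<^sub>v m"
  using assms by (intro eq_vecI) auto

lemma scalar_prod_self_nonneg: "0 \<le> v \<bullet> (v :: real vec)"
  by (auto simp: scalar_prod_def intro: sum_nonneg)

lemma scalar_prod_self_eq_0:
  fixes v :: "real vec"
  assumes "v \<in> carrier_vec n" "v \<bullet> v = 0"
  shows "v = 0\<^sub>v n"
proof -
  have "\<forall>i\<in>{0..<n}. v $ i * v $ i = 0"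
    using assms by (subst sum_nonneg_eq_0_iff[symmetric]) (auto simp: scalar_prod_def)
  then show ?thesis using assms(1) by (intro eq_vecI) auto
qed

lemma scalar_prod_gram:
  fixes G :: "real mat"
  assumes "G \<in> carrier_mat m n" "v \<in> carrier_vec n"
  shows "v \<bullet> (transpose_mat G * G *\<^sub>v v) = (G *\<^sub>v v) \<bullet> (G *\<^sub>v v)"
proof -
  have "v \<bullet> (transpose_mat G * G *\<^sub>v v) = (transpose_mat (transpose_mat G) *\<^sub>v v) \<bullet> (G *\<^sub>v v)"
    using assms by (subst transpose_vec_mult_scalar[of _ n m]) auto
  then show ?thesis by simp
qed

lemma positive_definite_invertible:
  assumes "positive_definite n A"
  shows "invertible_mat A"
proof -
  have A: "A \<in> carrier_mat n n" using assms by (simp add: positive_definite_def)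
  show ?thesis
    using ln_det_le_trace(1)[OF assms] by (simp add: invertible_mat_iff_det[OF A])
qed

lemma invertible_transpose:
  fixes A :: "real mat"
  assumes "A \<in> carrier_mat n n" "invertible_mat A"
  shows "invertible_mat (transpose_mat A)"
  using assms by (simp add: invertible_mat_iff_det[of _ n] det_transpose)

lemma invertible_mult:
  fixes A B :: "real mat"
  assumes "A \<in> carrier_mat n n" "B \<in> carrier_mat n n" "invertible_mat A" "invertible_mat B"
  shows "invertible_mat (A * B)"
  using assms by (simp add: invertible_mat_iff_det[of _ n] det_mult[of _ n])

lemma positive_definite_one: "positive_definite n (1\<^sub>m n)"
  unfolding positive_definite_def
proof (intro conjI ballI impI)
  fix v :: "real vec" assume v: "v \<in> carrier_vec n" "v \<noteq> 0\<^sub>v n"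
  then show "0 < v \<bullet> (1\<^sub>m n *\<^sub>v v)"
    using scalar_prod_self_nonneg[of v] scalar_prod_self_eq_0[of v n] by force
qed auto

lemma positive_definite_congruence:
  assumes "positive_definite n A" "P \<in> carrier_mat n n" "invertible_mat P"
  shows "positive_definite n (P * A * transpose_mat P)"
  unfolding positive_definite_def
proof (intro conjI ballI impI)
  have A: "A \<in> carrier_mat n n" and sym: "transpose_mat A = A"
    and pd: "\<And>v. v \<in> carrier_vec n \<Longrightarrow> v \<noteq> 0\<^sub>v n \<Longrightarrow> 0 < v \<bullet> (A *\<^sub>v v)"
    using assms by (auto simp: positive_definite_def)
  have PT: "transpose_mat P \<in> carrier_mat n n" using assms by simp
  show "P * A * transpose_mat P \<in> carrier_mat n n" using A assms by simp
  show "transpose_mat (P * A * transpose_mat P) = P * A * transpose_mat P"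
    using A assms by (simp add: transpose_mult[of _ n n _ n] sym)
  fix v :: "real vec" assume v: "v \<in> carrier_vec n" "v \<noteq> 0\<^sub>v n"
  let ?w = "transpose_mat P *\<^sub>v v"
  have "?w \<noteq> 0\<^sub>v n"
    using invertible_transpose[OF assms(2,3)] v invertible_mat_iff_kernel[OF PT] by blast
  then have "0 < ?w \<bullet> (A *\<^sub>v ?w)" using pd v PT by simp
  also have "\<dots> = v \<bullet> (P *\<^sub>v (A *\<^sub>v ?w))"
    using v A assms(2) PT by (subst transpose_vec_mult_scalar[of _ n n]) auto
  also have "P *\<^sub>v (A *\<^sub>v ?w) = P * A * transpose_mat P *\<^sub>v v"
    using v A assms(2) PT
    by (simp add: assoc_mult_mat_vec[of _ n n _ n] assoc_mult_mat[of _ n n _ n _ n])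
  finally show "0 < v \<bullet> (P * A * transpose_mat P *\<^sub>v v)" .
qed

text \<open>The identity is positive definite and congruences preserve this; conversely a Cholesky
  factor serves as \<open>W\<close>. Candidates can thus be treated as Gram matrices or as positive
  definite matrices, whichever suits.\<close>

lemma covariance_params_eq: "covariance_params d = {S. positive_definite d S}"
proof (intro equalityI subsetI)
  fix S assume "S \<in> covariance_params d"
  then obtain W where W: "W \<in> carrier_mat d d" "invertible_mat W" "S = W * transpose_mat W"
    by (auto simp: covariance_params_def)
  then show "S \<in> {S. positive_definite d S}"
    using positive_definite_congruence[OF positive_definite_one W(1,2)] by simp
next
  fix S assume "S \<in> {S. positive_definite d S}"
  then have S: "positive_definite d S" by simp
  obtain L where L: "L \<in> carrier_mat d d" "S = L * transpose_mat L"
    using cholesky[OF S] by blast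
  have "Determinant.det S \<noteq> 0" using ln_det_le_trace(1)[OF S] by simp
  then have "Determinant.det L \<noteq> 0" using L by (auto simp: det_mult[of _ d])
  then show "S \<in> covariance_params d"
    using L by (auto simp: covariance_params_def invertible_mat_iff_det[OF L(1)])
qed

section \<open>Traces and quadratic forms of finite sums\<close>

lemma mat_trace_mult_commute:
  assumes "A \<in> carrier_mat n m" "B \<in> carrier_mat m n"
  shows "mat_trace (A * B) = mat_trace (B * A)"
proof -
  have "mat_trace (A * B) = (\<Sum>i<n. \<Sum>k<m. A $$ (i, k) * B $$ (k, i))"
    using assms by (auto simp: mat_trace_def scalar_prod_def lessThan_atLeast0)
  also have "\<dots> = (\<Sum>k<m. \<Sum>i<n. A $$ (i, k) * B $$ (k, i))" by (rule sum.swap)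
  also have "\<dots> = mat_trace (B * A)"
    using assms by (auto simp: mat_trace_def scalar_prod_def lessThan_atLeast0 mult.commute)
  finally show ?thesis .
qed

lemma mat_trace_mult_smult:
  assumes "Q \<in> carrier_mat n n" "A \<in> carrier_mat n n"
  shows "mat_trace (Q * (c \<cdot>\<^sub>m A)) = c * mat_trace (Q * A)"
  using assms by (auto simp: mat_trace_def scalar_prod_def sum_distrib_left intro!: sum.cong)

lemma mat_trace_mult_mat_sum:
  assumes "Q \<in> carrier_mat d d" "\<And>i. i \<in> I \<Longrightarrow> A i \<in> carrier_mat d d"
  shows "mat_trace (Q * mat_sum d A I) = (\<Sum>i\<in>I. mat_trace (Q * A i))"
proof -
  have "mat_trace (Q * mat_sum d A I) = (\<Sum>j<d. \<Sum>k<d. \<Sum>i\<in>I. Q $$ (j, k) * A i $$ (k, j))"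
    using assms(1)
    by (auto simp: mat_trace_def scalar_prod_def lessThan_atLeast0 mat_sum_def sum_distrib_left)
  also have "\<dots> = (\<Sum>j<d. \<Sum>i\<in>I. \<Sum>k<d. Q $$ (j, k) * A i $$ (k, j))"
    by (intro sum.cong refl sum.swap)
  also have "\<dots> = (\<Sum>i\<in>I. \<Sum>j<d. \<Sum>k<d. Q $$ (j, k) * A i $$ (k, j))"
    by (rule sum.swap)
  also have "\<dots> = (\<Sum>i\<in>I. mat_trace (Q * A i))"
    using assms
    by (intro sum.cong refl) (auto simp: mat_trace_def scalar_prod_def lessThan_atLeast0 carrier_matD[OF assms(2)])
  finally show ?thesis .
qed

lemma scalar_prod_mat_sum:
  assumes "v \<in> carrier_vec d" "\<And>i. i \<in> I \<Longrightarrow> A i \<in> carrier_mat d d"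
  shows "v \<bullet> (mat_sum d A I *\<^sub>v v) = (\<Sum>i\<in>I. v \<bullet> (A i *\<^sub>v v))"
proof -
  have "v \<bullet> (mat_sum d A I *\<^sub>v v) = (\<Sum>j<d. \<Sum>k<d. \<Sum>i\<in>I. v $ j * A i $$ (j, k) * v $ k)"
    using assms(1)
    by (subst quadratic_form_sum[of _ d]) (auto simp: mat_sum_def sum_distrib_left sum_distrib_right)
  also have "\<dots> = (\<Sum>j<d. \<Sum>i\<in>I. \<Sum>k<d. v $ j * A i $$ (j, k) * v $ k)"
    by (intro sum.cong refl sum.swap)
  also have "\<dots> = (\<Sum>i\<in>I. \<Sum>j<d. \<Sum>k<d. v $ j * A i $$ (j, k) * v $ k)"
    by (rule sum.swap)
  also have "\<dots> = (\<Sum>i\<in>I. v \<bullet> (A i *\<^sub>v v))"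
    using assms by (intro sum.cong refl) (simp add: quadratic_form_sum[of _ d])
  finally show ?thesis .
qed

section \<open>Stein's loss\<close>

text \<open>Stein's loss \<open>tr (S^-1 A) - ln |S^-1 A| - d\<close> without the terms that depend
  on \<open>A\<close> alone, so that it still makes sense for singular \<open>A\<close>.\<close>

definition stein_loss :: "real mat \<Rightarrow> real mat \<Rightarrow> real" where
  "stein_loss A S = ln (Determinant.det S) + mat_trace (mat_inv S * A)"

lemma gram_inverse:
  fixes W P :: "real mat"
  assumes "W \<in> carrier_mat d d" "P \<in> carrier_mat d d" "P * W = 1\<^sub>m d"
  shows "mat_inv (W * transpose_mat W) = transpose_mat P * P"
proof (rule mat_inv_eqI[of _ d])
  have "W * P = 1\<^sub>m d" using mat_mult_left_right_inverse[OF assms(2,1,3)] .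
  then have PW: "transpose_mat P * transpose_mat W = 1\<^sub>m d"
    using transpose_mult[OF assms(1,2)] by simp
  have "transpose_mat P * P * (W * transpose_mat W) = transpose_mat P * ((P * W) * transpose_mat W)"
    using assms(1,2) by (simp add: assoc_mult_mat[of _ d d _ d _ d])
  then show "transpose_mat P * P * (W * transpose_mat W) = 1\<^sub>m d"
    using assms PW by simp
qed (use assms in auto)

text \<open>\<open>S^-1 A\<close> is not symmetric in general. Cyclicity of the trace trades it for
  \<open>P A P^T\<close> with \<open>P = W^-1\<close>, which inherits symmetry and definiteness from
  \<open>A\<close>.\<close>

lemma stein_loss_gram:
  assumes "W \<in> carrier_mat d d" "P \<in> carrier_mat d d" "P * W = 1\<^sub>m d" "A \<in> carrier_mat d d"
  shows "stein_loss A (W * transpose_mat W) =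
    ln (Determinant.det (W * transpose_mat W)) + mat_trace (P * A * transpose_mat P)"
proof -
  have "mat_trace (transpose_mat P * P * A) = mat_trace (transpose_mat P * (P * A))"
    using assms by (simp add: assoc_mult_mat[of _ d d _ d _ d])
  also have "\<dots> = mat_trace (P * A * transpose_mat P)"
    by (rule mat_trace_mult_commute[of _ d d]) (use assms in auto)
  finally show ?thesis
    using gram_inverse[OF assms(1-3)] by (simp add: stein_loss_def)
qed

lemma mat_trace_one: "mat_trace (1\<^sub>m n) = real n"
  by (simp add: mat_trace_def)

lemma stein_loss_self:
  assumes "positive_definite d A"
  shows "stein_loss A A = ln (Determinant.det A) + real d"
proof -
  have A: "A \<in> carrier_mat d d" using assms by (simp add: positive_definite_def)
  obtain B where B: "B \<in> carrier_mat d d" "A * B = 1\<^sub>m d" "B * A = 1\<^sub>m d"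
    using invertible_mat_obtain_inverse[OF A positive_definite_invertible[OF assms]] .
  show ?thesis
    using B mat_inv_eqI[OF A B(1,3)] by (simp add: stein_loss_def mat_trace_one)
qed

lemma stein_loss_minimum:
  assumes A: "positive_definite d A" and S: "S \<in> covariance_params d"
  shows "stein_loss A A \<le> stein_loss A S" "stein_loss A S = stein_loss A A \<Longrightarrow> S = A"
proof -
  have Ac: "A \<in> carrier_mat d d" using A by (simp add: positive_definite_def)
  obtain W where W: "W \<in> carrier_mat d d" "invertible_mat W" "S = W * transpose_mat W"
    using S by (auto simp: covariance_params_def)
  obtain P where P: "P \<in> carrier_mat d d" "W * P = 1\<^sub>m d" "P * W = 1\<^sub>m d"
    using invertible_mat_obtain_inverse[OF W(1,2)] .
  have invP: "invertible_mat P" using invertible_matI[OF P(1) W(1) P(3)] .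
  define C where "C = P * A * transpose_mat P"
  have pdC: "positive_definite d C"
    unfolding C_def by (rule positive_definite_congruence[OF A P(1) invP])
  have dP: "Determinant.det P * Determinant.det W = 1"
    using det_mult[OF P(1) W(1)] P(3) by simp
  have dS: "Determinant.det S = (Determinant.det W)\<^sup>2"
    using W by (simp add: det_mult[of _ d] det_transpose power2_eq_square)
  have "Determinant.det C = (Determinant.det P)\<^sup>2 * Determinant.det A"
    using P(1) Ac unfolding C_def by (simp add: det_mult[of _ d] det_transpose power2_eq_square)
  \<comment> \<open>\<open>|C| |S| = |A|\<close>: after taking logarithms, the difference of the two
    losses is exactly the gap of \<open>ln_det_le_trace\<close>.\<close>
  then have "Determinant.det C * Determinant.det S = (Determinant.det P * Determinant.det W)\<^sup>2 * Determinant.det A"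
    unfolding dS by (simp add: power2_eq_square)
  then have "Determinant.det C * Determinant.det S = Determinant.det A"
    by (simp add: dP)
  moreover have "0 < Determinant.det S"
    using S ln_det_le_trace(1) by (simp add: covariance_params_eq)
  ultimately have lnA: "ln (Determinant.det A) = ln (Determinant.det C) + ln (Determinant.det S)"
    using ln_mult_pos[OF ln_det_le_trace(1)[OF pdC]] by metis
  have loss: "stein_loss A S - stein_loss A A = mat_trace C - real d - ln (Determinant.det C)"
    using stein_loss_gram[OF W(1) P(1,3) Ac] stein_loss_self[OF A] lnA
    by (simp add: W(3) C_def)
  then show "stein_loss A A \<le> stein_loss A S"
    using ln_det_le_trace(2)[OF pdC] by linarith
  assume "stein_loss A S = stein_loss A A"
  then have "C = 1\<^sub>m d" using ln_det_le_trace(3)[OF pdC] loss by linarith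
  \<comment> \<open>Undoing the congruence: \<open>W C W^T\<close> is \<open>S\<close> because
    \<open>C\<close> is the identity, and it is \<open>A\<close> because \<open>W P\<close> is the
    identity.\<close>
  then have "W * C * transpose_mat W = S" using W by simp
  moreover have "W * C * transpose_mat W = (W * P) * A * (transpose_mat P * transpose_mat W)"
    using W(1) P(1) Ac by (simp add: C_def assoc_mult_mat[of _ d d _ d _ d])
  moreover have "transpose_mat P * transpose_mat W = 1\<^sub>m d"
    using transpose_mult[OF W(1) P(1)] P by simp
  ultimately show "S = A" using P Ac by simp
qed

text \<open>Shrinking \<open>S\<close> along a direction in the kernel of \<open>A\<close> leaves the trace term unchanged and
  decreases the determinant.\<close>

lemma stein_loss_no_minimum:
  assumes A: "A \<in> carrier_mat d d" "\<not> invertible_mat A" and S: "S \<in> covariance_params d"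
  shows "\<exists>S'\<in>covariance_params d. stein_loss A S' < stein_loss A S"
proof -
  obtain W where W: "W \<in> carrier_mat d d" "invertible_mat W" "S = W * transpose_mat W"
    using S by (auto simp: covariance_params_def)
  obtain P where P: "P \<in> carrier_mat d d" "W * P = 1\<^sub>m d" "P * W = 1\<^sub>m d"
    using invertible_mat_obtain_inverse[OF W(1,2)] .
  have WT: "transpose_mat W \<in> carrier_mat d d" and PT: "transpose_mat P \<in> carrier_mat d d"
    using W P by auto
  have PW: "transpose_mat P * transpose_mat W = 1\<^sub>m d"
    using transpose_mult[OF W(1) P(1)] P by simp
  obtain v where v: "v \<in> carrier_vec d" "v \<noteq> 0\<^sub>v d" "A *\<^sub>v v = 0\<^sub>v d"
    using A invertible_mat_iff_kernel[OF A(1)] by blast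
  \<comment> \<open>The kernel direction in the coordinates that turn \<open>S\<close> into the
    identity: \<open>P^T u = v\<close>, so \<open>u\<close> lies in the kernel of
    \<open>P A P^T\<close>.\<close>
  define u where "u = transpose_mat W *\<^sub>v v"
  have u: "u \<in> carrier_vec d" using WT v by (simp add: u_def)
  have "u \<noteq> 0\<^sub>v d"
    using invertible_transpose[OF W(1,2)] v invertible_mat_iff_kernel[OF WT] by (auto simp: u_def)
  then have N: "0 < u \<bullet> u"
    using scalar_prod_self_nonneg[of u] scalar_prod_self_eq_0[OF u] by force
  \<comment> \<open>Orthogonal projection onto the line of \<open>u\<close>.\<close>
  define U where "U = mat d d (\<lambda>(i, j). u $ i * u $ j / (u \<bullet> u))"
  have U: "U \<in> carrier_mat d d" "transpose_mat U = U"
    by (auto simp: U_def intro!: eq_matI)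
  have UU: "U * U = U"
  proof (rule eq_matI)
    fix i j assume ij: "i < dim_row U" "j < dim_col U"
    then have ij: "i < d" "j < d" by (auto simp: U_def)
    have "(U * U) $$ (i, j) = (\<Sum>k<d. (u $ i * u $ j / ((u \<bullet> u) * (u \<bullet> u))) * (u $ k * u $ k))"
      using ij by (auto simp: U_def scalar_prod_def lessThan_atLeast0 intro!: sum.cong)
    also have "\<dots> = (u $ i * u $ j / ((u \<bullet> u) * (u \<bullet> u))) * (u \<bullet> u)"
      using u by (simp only: sum_distrib_left[symmetric]) (simp add: scalar_prod_def lessThan_atLeast0)
    also have "\<dots> = U $$ (i, j)" using ij N by (simp add: U_def)
    finally show "(U * U) $$ (i, j) = U $$ (i, j)" .
  qed (auto simp: U_def)
  have trU: "mat_trace U = 1"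
  proof -
    have "mat_trace U = (u \<bullet> u) / (u \<bullet> u)"
      using u by (simp add: U_def mat_trace_def scalar_prod_def sum_divide_distrib[symmetric]
        lessThan_atLeast0)
    then show ?thesis using N by simp
  qed
  \<comment> \<open>\<open>E a\<close> multiplies by \<open>1 + a\<close> along \<open>u\<close> and
    fixes the orthogonal complement; the composition law below is
    \<open>(1 + a) (1 + b) = 1 + (a + b + a b)\<close>.\<close>
  define E where "E a = 1\<^sub>m d + a \<cdot>\<^sub>m U" for a :: real
  have E: "E a \<in> carrier_mat d d" "transpose_mat (E a) = E a" for a
    by (auto simp: E_def U_def intro!: eq_matI)
  have EE: "E a * E b = E (a + b + a * b)" for a b
  proof -
    have "E a * E b = E a + b \<cdot>\<^sub>m (E a * U)"
      using U(1) E(1)[of a] unfolding E_def[of b]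
      by (subst mult_add_distrib_mat[of _ d d]) (auto simp: mult_smult_distrib[of _ d d])
    also have "E a * U = U + a \<cdot>\<^sub>m U"
      using U(1) unfolding E_def
      by (subst add_mult_distrib_mat[of _ d d]) (auto simp: mult_smult_assoc_mat[of _ d d] UU)
    also have "E a + b \<cdot>\<^sub>m (U + a \<cdot>\<^sub>m U) = E (a + b + a * b)"
      using U(1) by (intro eq_matI) (auto simp: E_def algebra_simps)
    finally show ?thesis .
  qed
  define C where "C = P * A * transpose_mat P"
  have C: "C \<in> carrier_mat d d" using P A by (simp add: C_def)
  have "C *\<^sub>v u = P *\<^sub>v (A *\<^sub>v ((transpose_mat P * transpose_mat W) *\<^sub>v v))"
    using P(1) A(1) PT WT v(1) unfolding C_def u_def
    by (simp add: assoc_mult_mat_vec[of _ d d _ d] assoc_mult_mat[of _ d d _ d _ d])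
  then have Cu: "C *\<^sub>v u = 0\<^sub>v d"
    using P v by (simp add: PW mult_mat_zero_vec[OF P(1)])
  have "C * U = 0\<^sub>m d d"
  proof (rule eq_matI)
    fix i j assume "i < dim_row (0\<^sub>m d d)" "j < dim_col (0\<^sub>m d d)"
    then have ij: "i < d" "j < d" by auto
    have "(C * U) $$ (i, j) = (\<Sum>k<d. C $$ (i, k) * u $ k) * (u $ j / (u \<bullet> u))"
      using ij C unfolding sum_distrib_right
      by (auto simp: U_def scalar_prod_def lessThan_atLeast0 intro!: sum.cong)
    also have "(\<Sum>k<d. C $$ (i, k) * u $ k) = (C *\<^sub>v u) $ i"
      using ij C u by (simp add: scalar_prod_def lessThan_atLeast0)
    finally show "(C * U) $$ (i, j) = 0\<^sub>m d d $$ (i, j)"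
      using ij by (simp add: Cu)
  qed (use C U in auto)
  then have CE: "C * E a = C" for a
    using C U(1) unfolding E_def
    by (subst mult_add_distrib_mat[of _ d d]) (auto simp: mult_smult_distrib[of _ d d])
  \<comment> \<open>The factor is halved along \<open>u\<close>. Doubling, \<open>E 1\<close>,
    undoes this, and the Gram matrix is scaled by 1/4 in that direction, which is
    \<open>E (- 3 / 4)\<close>.\<close>
  define V where "V = W * E (- 1 / 2)"
  have E1: "E 0 = 1\<^sub>m d" using U(1) by (auto simp: E_def intro!: eq_matI)
  have inv: "E 1 * E (- 1 / 2) = 1\<^sub>m d" "E (- 1 / 2) * E 1 = 1\<^sub>m d"
    by (simp_all add: EE E1)
  have V: "V \<in> carrier_mat d d" "invertible_mat V"
    using W(1) E(1) invertible_mult[OF W(1) E(1) W(2) invertible_matI[OF E(1) E(1) inv(2)]]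
    by (simp_all add: V_def)
  have Q: "E 1 * P \<in> carrier_mat d d" by (rule mult_carrier_mat[OF E(1) P(1)])
  have "E 1 * P * V = E 1 * ((P * W) * E (- 1 / 2))"
    using W(1) P(1) E(1) by (simp add: V_def assoc_mult_mat[of _ d d _ d _ d])
  then have QV: "E 1 * P * V = 1\<^sub>m d"
    by (simp only: P(3) left_mult_one_mat[OF E(1)] inv)
  have "stein_loss A (V * transpose_mat V) = ln (Determinant.det (V * transpose_mat V)) +
      mat_trace (E 1 * P * A * transpose_mat (E 1 * P))"
    using stein_loss_gram[OF V(1) Q QV A(1)] by simp
  also have "E 1 * P * A * transpose_mat (E 1 * P) = E 1 * (C * E 1)"
    using E P(1) A(1) PT by (simp add: C_def transpose_mult[of _ d d] assoc_mult_mat[of _ d d _ d _ d])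
  also have "\<dots> = E 1 * C" by (simp add: CE)
  also have "mat_trace (E 1 * C) = mat_trace (C * E 1)"
    by (rule mat_trace_mult_commute[OF E(1) C])
  also have "\<dots> = mat_trace C" by (simp add: CE)
  finally have loss: "stein_loss A (V * transpose_mat V) =
      ln (Determinant.det (V * transpose_mat V)) + mat_trace C" .
  have "positive_definite d (E (- 1 / 2) * 1\<^sub>m d * transpose_mat (E (- 1 / 2)))"
    by (rule positive_definite_congruence[OF positive_definite_one E(1)
      invertible_matI[OF E(1) E(1) inv(2)]])
  moreover have "E (- 1 / 2) * 1\<^sub>m d * transpose_mat (E (- 1 / 2)) = E (- 3 / 4)"
    using right_mult_one_mat[OF E(1)] by (simp add: E(2) EE)
  ultimately have pdE: "positive_definite d (E (- 3 / 4))" by simp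
  have "mat_trace (E a) = real d + a * mat_trace U" for a
    using U(1) by (simp add: E_def mat_trace_def sum.distrib sum_distrib_left)
  \<comment> \<open>The trace bound already gives a logarithm of at most \<open>- 3 / 4\<close>;
    only its sign matters.\<close>
  then have lnE: "ln (Determinant.det (E (- 3 / 4))) < 0"
    using ln_det_le_trace(2)[OF pdE] trU by simp
  have "V * transpose_mat V = W * (E (- 1 / 2) * E (- 1 / 2)) * transpose_mat W"
    unfolding V_def transpose_mult[OF W(1) E(1)] E(2)
    by (simp only: assoc_mult_mat[OF W(1) E(1) mult_carrier_mat[OF E(1) WT]]
      assoc_mult_mat[OF W(1) mult_carrier_mat[OF E(1) E(1)] WT] assoc_mult_mat[OF E(1) E(1) WT])
  then have "V * transpose_mat V = W * E (- 3 / 4) * transpose_mat W"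
    by (simp add: EE)
  then have "Determinant.det (V * transpose_mat V) =
      Determinant.det S * Determinant.det (E (- 3 / 4))"
    using W E(1)[of "- 3 / 4"] WT by (simp add: det_mult[of _ d])
  moreover have "0 < Determinant.det S"
    using S ln_det_le_trace(1) by (simp add: covariance_params_eq)
  ultimately have "ln (Determinant.det (V * transpose_mat V)) < ln (Determinant.det S)"
    using lnE ln_mult_pos[OF _ ln_det_le_trace(1)[OF pdE]] by simp
  moreover have "stein_loss A S = ln (Determinant.det S) + mat_trace C"
    using stein_loss_gram[OF W(1) P(1,3) A(1)] by (simp add: W(3) C_def)
  ultimately have "stein_loss A (V * transpose_mat V) < stein_loss A S"
    using loss by simp
  moreover have "V * transpose_mat V \<in> covariance_params d"
    using V by (auto simp: covariance_params_def)
  ultimately show ?thesis by blast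
qed

section \<open>The covariance matrix of the bridge\<close>

text \<open>Row \<open>r\<close> is the increment from time \<open>r\<close> to \<open>r + 1\<close>
  of a path that is 0 at times 0 and \<open>T\<close>; column \<open>c\<close> carries the value at
  time \<open>c + 1\<close>. Hence \<open>D^T D\<close> is the discrete Laplacian with Dirichlet
  boundary values.\<close>

definition difference_mat :: "nat \<Rightarrow> real mat" where
  "difference_mat T = mat T (T - 1) (\<lambda>(r, c). if r = c then 1 else if r = Suc c then - 1 else 0)"

lemma difference_mat_carrier: "difference_mat T \<in> carrier_mat T (T - 1)"
  by (simp add: difference_mat_def)

lemma bridge_cov_carrier: "bridge_cov T \<in> carrier_mat (T - 1) (T - 1)"
  by (simp add: bridge_cov_def)

text \<open>The rows of the inverse of \<open>bridge_cov T\<close> are second differences, and the columns of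
  \<open>bridge_cov T\<close> are the tent functions that they annihilate off the peak.\<close>

lemma difference_mat_bridge_cov:
  assumes "T \<ge> 1"
  shows "difference_mat T * bridge_cov T = mat T (T - 1) (\<lambda>(r, q).
    if r \<le> q then (real T - real (Suc q)) / real T else - real (Suc q) / real T)"
    (is "_ = ?R")
proof (rule eq_matI)
  fix r q assume "r < dim_row ?R" "q < dim_col ?R"
  then have rq: "r < T" "q < T - 1" by auto
  let ?s = "\<lambda>c. bridge_cov T $$ (c, q)"
  have "(difference_mat T * bridge_cov T) $$ (r, q) = (\<Sum>c<T - 1. difference_mat T $$ (r, c) * ?s c)"
    using rq by (simp add: scalar_prod_def difference_mat_def bridge_cov_def lessThan_atLeast0)
  \<comment> \<open>The guard \<open>1 \<le> r\<close> excludes row 0, which has no entry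
    \<open>- 1\<close> although the truncated \<open>r - 1\<close> would point to column 0.\<close>
  also have "\<dots> = (\<Sum>c<T - 1. if c = r then ?s r else 0) -
      (\<Sum>c<T - 1. if c = r - 1 then (if 1 \<le> r then ?s (r - 1) else 0) else 0)"
    unfolding sum_subtractf[symmetric]
    using rq by (intro sum.cong refl) (auto simp: difference_mat_def)
  also have "\<dots> = (if r < T - 1 then ?s r else 0) - (if 1 \<le> r then ?s (r - 1) else 0)"
    using rq by (auto simp: sum.delta)
  also have "\<dots> = ?R $$ (r, q)"
  proof (cases "r \<le> q")
    case True
    then have "min r q = r" "max r q = q" "min (r - 1) q = r - 1" "max (r - 1) q = q" by auto
    then show ?thesis
      using rq True by (cases r) (auto simp: bridge_cov_def Let_def of_nat_diff field_simps)
  next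
    case False
    then have mm: "min r q = q" "max r q = r" "min (r - 1) q = q" "max (r - 1) q = r - 1" by auto
    \<comment> \<open>The last row has no column for time \<open>T\<close>, but the formula extends
      to it: the covariance with the pinned endpoint is 0.\<close>
    have "(if r < T - 1 then ?s r else 0) = real (Suc q) * (real T - real (Suc r)) / real T"
    proof (cases "r < T - 1")
      case True
      then show ?thesis using rq mm by (simp add: bridge_cov_def Let_def)
    next
      case f: False
      then have "Suc r = T" using rq by simp
      then show ?thesis using f by simp
    qed
    moreover have "(if 1 \<le> r then ?s (r - 1) else 0) = real (Suc q) * (real T - real r) / real T"
      using rq False mm by (simp add: bridge_cov_def Let_def)
    ultimately show ?thesis
      using rq False by (simp add: field_simps)
  qed
  finally show "(difference_mat T * bridge_cov T) $$ (r, q) = ?R $$ (r, q)" .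
qed (auto simp: difference_mat_def bridge_cov_def)

lemma difference_mat_gram_bridge_cov:
  assumes "T \<ge> 1"
  shows "transpose_mat (difference_mat T) * difference_mat T * bridge_cov T = 1\<^sub>m (T - 1)"
proof -
  define R :: "real mat" where "R = mat T (T - 1) (\<lambda>(r, q).
    if r \<le> q then (real T - real (Suc q)) / real T else - real (Suc q) / real T)"
  have "transpose_mat (difference_mat T) * difference_mat T * bridge_cov T =
      transpose_mat (difference_mat T) * R"
    using difference_mat_carrier[of T] bridge_cov_carrier[of T] difference_mat_bridge_cov[OF assms]
    by (simp add: R_def)
  also have "\<dots> = 1\<^sub>m (T - 1)"
  proof (rule eq_matI)
    fix p q assume "p < dim_row (1\<^sub>m (T - 1))" "q < dim_col (1\<^sub>m (T - 1))"
    then have pq: "p < T - 1" "q < T - 1" by auto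
    have "(transpose_mat (difference_mat T) * R) $$ (p, q) =
        (\<Sum>r<T. difference_mat T $$ (r, p) * R $$ (r, q))"
      using pq by (simp add: scalar_prod_def difference_mat_def R_def lessThan_atLeast0)
    also have "\<dots> = (\<Sum>r<T. if r = p then R $$ (p, q) else 0) -
        (\<Sum>r<T. if r = Suc p then R $$ (Suc p, q) else 0)"
      unfolding sum_subtractf[symmetric]
      using pq by (intro sum.cong refl) (auto simp: difference_mat_def)
    also have "\<dots> = R $$ (p, q) - R $$ (Suc p, q)"
      using pq by (auto simp: sum.delta)
    \<comment> \<open>\<open>R\<close> holds the slopes of the tent with peak at time
      \<open>q + 1\<close>. They are constant on either side and drop across the peak by
      \<open>(T - (q + 1)) / T + (q + 1) / T = 1\<close>.\<close>
    also have "\<dots> = 1\<^sub>m (T - 1) $$ (p, q)"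
      using pq assms by (auto simp: R_def field_simps)
    finally show "(transpose_mat (difference_mat T) * R) $$ (p, q) = 1\<^sub>m (T - 1) $$ (p, q)" .
  qed (auto simp: difference_mat_def R_def)
  finally show ?thesis .
qed

lemma mat_inv_bridge_cov:
  assumes "T \<ge> 1"
  shows "mat_inv (bridge_cov T) = transpose_mat (difference_mat T) * difference_mat T"
  using difference_mat_carrier[of T]
  by (intro mat_inv_eqI[OF bridge_cov_carrier _ difference_mat_gram_bridge_cov[OF assms]]) auto

lemma difference_mat_kernel:
  assumes "T \<ge> 1" "v \<in> carrier_vec (T - 1)" "difference_mat T *\<^sub>v v = 0\<^sub>v T"
  shows "v = 0\<^sub>v (T - 1)"
proof -
  let ?D = "difference_mat T"
  note D = difference_mat_carrier[of T] bridge_cov_carrier[of T]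
  have K: "transpose_mat ?D * ?D \<in> carrier_mat (T - 1) (T - 1)" using D by auto
  have "bridge_cov T * (transpose_mat ?D * ?D) = 1\<^sub>m (T - 1)"
    by (rule mat_mult_left_right_inverse[OF K D(2) difference_mat_gram_bridge_cov[OF assms(1)]])
  then have "v = bridge_cov T *\<^sub>v (transpose_mat ?D * ?D *\<^sub>v v)"
    using assoc_mult_mat_vec[OF D(2) K assms(2)] assms(2) by simp
  also have "transpose_mat ?D * ?D *\<^sub>v v = transpose_mat ?D *\<^sub>v (?D *\<^sub>v v)"
    using D assms(2) by (intro assoc_mult_mat_vec) auto
  also have "bridge_cov T *\<^sub>v \<dots> = 0\<^sub>v (T - 1)"
    using mult_mat_zero_vec[OF D(2)] mult_mat_zero_vec[of "transpose_mat ?D" "T - 1" T] D(1)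
    by (simp add: assms(3))
  finally show ?thesis .
qed

text \<open>With \<open>K = D^T D\<close> the inverse and \<open>u\<close> the image of
  \<open>v\<close> under \<open>bridge_cov T\<close>, one has \<open>v = K u\<close>. The form of
  the covariance at \<open>v\<close> is thus the form of \<open>K\<close> at \<open>u\<close>, a sum
  of squares.\<close>

lemma bridge_cov_positive:
  assumes "T \<ge> 1" "v \<in> carrier_vec (T - 1)" "v \<noteq> 0\<^sub>v (T - 1)"
  shows "0 < v \<bullet> (bridge_cov T *\<^sub>v v)"
proof -
  let ?D = "difference_mat T"
  note D = difference_mat_carrier[of T] bridge_cov_carrier[of T]
  have K: "transpose_mat ?D * ?D \<in> carrier_mat (T - 1) (T - 1)" using D by auto
  define u where "u = bridge_cov T *\<^sub>v v"
  have u: "u \<in> carrier_vec (T - 1)" using D assms by (simp add: u_def)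
  have v: "v = transpose_mat ?D * ?D *\<^sub>v u"
    using assoc_mult_mat_vec[OF K D(2) assms(2)] difference_mat_gram_bridge_cov[OF assms(1)] assms(2)
    by (simp add: u_def)
  have "v \<bullet> u = u \<bullet> v" by (rule comm_scalar_prod[OF assms(2) u])
  also have "\<dots> = (?D *\<^sub>v u) \<bullet> (?D *\<^sub>v u)"
    using scalar_prod_gram[OF D(1) u] v by simp
  finally have eq: "v \<bullet> u = (?D *\<^sub>v u) \<bullet> (?D *\<^sub>v u)" .
  have "?D *\<^sub>v u \<noteq> 0\<^sub>v T"
  proof
    assume "?D *\<^sub>v u = 0\<^sub>v T"
    then have "u = 0\<^sub>v (T - 1)" by (rule difference_mat_kernel[OF assms(1) u])
    then have "v = 0\<^sub>v (T - 1)" using v mult_mat_zero_vec[OF K] by simp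
    with assms(3) show False by simp
  qed
  then show ?thesis
    using eq scalar_prod_self_nonneg[of "?D *\<^sub>v u"] scalar_prod_self_eq_0[of "?D *\<^sub>v u" T] D u
    unfolding u_def[symmetric] by force
qed

section \<open>Scatter matrices as Gram matrices of increments\<close>

lemma interior_difference_carrier:
  "interior_points d T x - interior_means d T x \<in> carrier_mat d (T - 1)"
  by (auto simp: interior_points_def interior_means_def)

lemma bridge_scatter_gram:
  assumes "T \<ge> 1"
  shows "bridge_scatter d T x =
    transpose_mat (difference_mat T * transpose_mat (interior_points d T x - interior_means d T x)) *
    (difference_mat T * transpose_mat (interior_points d T x - interior_means d T x))"
proof -
  define X where "X = interior_points d T x - interior_means d T x"
  have X: "X \<in> carrier_mat d (T - 1)" unfolding X_def by (rule interior_difference_carrier)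
  have XT: "transpose_mat X \<in> carrier_mat (T - 1) d" using X by simp
  have D: "difference_mat T \<in> carrier_mat T (T - 1)" "transpose_mat (difference_mat T) \<in> carrier_mat (T - 1) T"
    using difference_mat_carrier[of T] by auto
  have "transpose_mat (difference_mat T * transpose_mat X) = X * transpose_mat (difference_mat T)"
    using transpose_mult[OF D(1) XT] by simp
  then show ?thesis
    unfolding bridge_scatter_def X_def[symmetric] mat_inv_bridge_cov[OF assms]
    by (simp only: assoc_mult_mat[OF X D(2,1), symmetric]
      assoc_mult_mat[OF mult_carrier_mat[OF X D(2)] D(1) XT])
qed

lemma bridge_scatter_carrier: "bridge_scatter d T x \<in> carrier_mat d d"
  using carrier_matD[OF interior_difference_carrier[of d T x]]
  by (intro carrier_matI) (simp_all only: bridge_scatter_def index_mult_mat index_transpose_mat)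

lemma bridge_scatter_transpose:
  assumes "T \<ge> 1"
  shows "transpose_mat (bridge_scatter d T x) = bridge_scatter d T x"
proof -
  define G where "G = difference_mat T * transpose_mat (interior_points d T x - interior_means d T x)"
  have G: "G \<in> carrier_mat T d"
    using interior_difference_carrier[of d T x] difference_mat_carrier[of T] by (simp add: G_def)
  have GT: "transpose_mat G \<in> carrier_mat d T" using G by simp
  show ?thesis
    unfolding bridge_scatter_gram[OF assms] G_def[symmetric]
    using transpose_mult[OF GT G] by simp
qed

text \<open>The form is the squared norm of \<open>G v\<close>, the rows of \<open>G\<close> being
  the increments of the centred path. If it vanishes, \<open>v\<close> is orthogonal to all
  increments and, since the difference matrix is injective, to all interior deviations.\<close>

lemma bridge_scatter_nonneg:
  assumes "T \<ge> 1" "v \<in> carrier_vec d"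
  shows "0 \<le> v \<bullet> (bridge_scatter d T x *\<^sub>v v)"
    and "v \<bullet> (bridge_scatter d T x *\<^sub>v v) = 0 \<Longrightarrow>
      transpose_mat (interior_points d T x - interior_means d T x) *\<^sub>v v = 0\<^sub>v (T - 1)"
proof -
  define X where "X = interior_points d T x - interior_means d T x"
  define G where "G = difference_mat T * transpose_mat X"
  have XT: "transpose_mat X \<in> carrier_mat (T - 1) d"
    using interior_difference_carrier[of d T x] by (simp add: X_def)
  have G: "G \<in> carrier_mat T d"
    using XT difference_mat_carrier[of T] by (simp add: G_def)
  have eq: "v \<bullet> (bridge_scatter d T x *\<^sub>v v) = (G *\<^sub>v v) \<bullet> (G *\<^sub>v v)"
    using scalar_prod_gram[OF G assms(2)] bridge_scatter_gram[OF assms(1), of d x]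
    by (simp add: G_def X_def)
  show "0 \<le> v \<bullet> (bridge_scatter d T x *\<^sub>v v)"
    unfolding eq by (rule scalar_prod_self_nonneg)
  assume "v \<bullet> (bridge_scatter d T x *\<^sub>v v) = 0"
  then have "G *\<^sub>v v = 0\<^sub>v T"
    using eq G assms(2) by (intro scalar_prod_self_eq_0) auto
  then have "difference_mat T *\<^sub>v (transpose_mat X *\<^sub>v v) = 0\<^sub>v T"
    using assoc_mult_mat_vec[OF difference_mat_carrier XT assms(2)] by (simp add: G_def)
  then show "transpose_mat (interior_points d T x - interior_means d T x) *\<^sub>v v = 0\<^sub>v (T - 1)"
    using XT assms(2) unfolding X_def[symmetric] by (intro difference_mat_kernel[OF assms(1)]) auto
qed

section \<open>The log-likelihood\<close>

text \<open>The scatter matrices enter linearly under the trace, so the sum collapses to a single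
  trace against \<open>m\<close> times the estimator, where \<open>m\<close> counts the interior
  points. This is the origin of the normalisation in \<open>sigma_hat\<close>.\<close>

lemma log_likelihood_stein_loss:
  assumes "0 < (\<Sum>i=1..n. T i - 1)" "\<And>i. i \<in> {1..n} \<Longrightarrow> T i \<ge> 1" "S \<in> covariance_params d"
  shows "log_likelihood d n T x S =
    1 / 2 * (- real d * ln (2 * pi) * (\<Sum>i=1..n. real (T i - 1))
      - real d * (\<Sum>i=1..n. ln (Determinant.det (bridge_cov (T i)))))
    - 1 / 2 * (\<Sum>i=1..n. real (T i - 1)) * stein_loss (sigma_hat d n T x) S"
proof -
  let ?m = "\<Sum>i=1..n. real (T i - 1)"
  let ?A = "mat_sum d (\<lambda>i. bridge_scatter d (T i) (x i)) {1..n}"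
  have m: "?m \<noteq> 0" using assms(1) by (metis less_irrefl of_nat_0_eq_iff of_nat_sum)
  have S: "S \<in> carrier_mat d d" "positive_definite d S"
    using assms(3) by (auto simp: covariance_params_eq positive_definite_def)
  obtain Q where Q: "Q \<in> carrier_mat d d" "S * Q = 1\<^sub>m d" "Q * S = 1\<^sub>m d"
    using invertible_mat_obtain_inverse[OF S(1) positive_definite_invertible[OF S(2)]] .
  have inv: "mat_inv S = Q" by (rule mat_inv_eqI[OF S(1) Q(1,3)])
  have "mat_trace (Q * (interior_points d (T i) (x i) - interior_means d (T i) (x i)) *
          mat_inv (bridge_cov (T i)) *
          transpose_mat (interior_points d (T i) (x i) - interior_means d (T i) (x i))) =
        mat_trace (Q * bridge_scatter d (T i) (x i))" if "T i \<ge> 1" for i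
  proof -
    define X where "X = interior_points d (T i) (x i) - interior_means d (T i) (x i)"
    have X: "X \<in> carrier_mat d (T i - 1)" unfolding X_def by (rule interior_difference_carrier)
    have K: "mat_inv (bridge_cov (T i)) \<in> carrier_mat (T i - 1) (T i - 1)"
      using difference_mat_carrier[of "T i"] by (simp add: mat_inv_bridge_cov[OF that])
    show ?thesis
      unfolding bridge_scatter_def X_def[symmetric]
      using X K Q(1) by (simp add: assoc_mult_mat[of _ d d _ "T i - 1"]
        assoc_mult_mat[of _ d "T i - 1" _ "T i - 1"])
  qed
  then have tr: "(\<Sum>i=1..n. mat_trace (Q * (interior_points d (T i) (x i) - interior_means d (T i) (x i)) *
          mat_inv (bridge_cov (T i)) *
          transpose_mat (interior_points d (T i) (x i) - interior_means d (T i) (x i)))) =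
        mat_trace (Q * ?A)"
    using assms(2)
    by (subst mat_trace_mult_mat_sum[OF Q(1) bridge_scatter_carrier]) (auto intro!: sum.cong)
  have "?m * mat_trace (Q * sigma_hat d n T x) = ?m * (inverse ?m * mat_trace (Q * ?A))"
    unfolding sigma_hat_def by (subst mat_trace_mult_smult[OF Q(1)]) (auto simp: mat_sum_def)
  also have "\<dots> = mat_trace (Q * ?A)" using m by simp
  finally have eq: "mat_trace (Q * ?A) = ?m * mat_trace (Q * sigma_hat d n T x)" ..
  show ?thesis
    unfolding log_likelihood_def inv tr stein_loss_def eq by (simp add: algebra_simps)
qed

lemma sigma_hat_carrier: "sigma_hat d n T x \<in> carrier_mat d d"
  by (simp add: sigma_hat_def mat_sum_def)

lemma scalar_prod_sigma_hat:
  assumes "v \<in> carrier_vec d"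
  shows "v \<bullet> (sigma_hat d n T x *\<^sub>v v) = inverse (\<Sum>i=1..n. real (T i - 1)) *
    (\<Sum>i=1..n. v \<bullet> (bridge_scatter d (T i) (x i) *\<^sub>v v))"
proof -
  let ?A = "mat_sum d (\<lambda>i. bridge_scatter d (T i) (x i)) {1..n}"
  have A: "?A \<in> carrier_mat d d" by (simp add: mat_sum_def)
  have scale: "v \<bullet> (c \<cdot>\<^sub>m ?A *\<^sub>v v) = c * (v \<bullet> (?A *\<^sub>v v))" for c
    using assms A
    by (auto simp: quadratic_form_sum[of _ d] sum_distrib_left mult.left_commute mult.assoc
      intro!: sum.cong)
  show ?thesis
    unfolding sigma_hat_def scale scalar_prod_mat_sum[OF assms bridge_scatter_carrier] ..
qed

lemma sigma_hat_transpose: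
  assumes "\<And>i. i \<in> {1..n} \<Longrightarrow> T i \<ge> 1"
  shows "transpose_mat (sigma_hat d n T x) = sigma_hat d n T x"
proof -
  have sym: "bridge_scatter d (T i) (x i) $$ (j, k) = bridge_scatter d (T i) (x i) $$ (k, j)"
    if "i \<in> {1..n}" "j < d" "k < d" for i j k
    using arg_cong[OF bridge_scatter_transpose[OF assms[OF that(1)], of d "x i"], of "\<lambda>A. A $$ (j, k)"]
      that bridge_scatter_carrier[of d "T i" "x i"] by simp
  show ?thesis
    by (rule eq_matI) (auto simp: sigma_hat_def mat_sum_def sym intro!: sum.cong)
qed

lemma scalar_prod_sigma_hat_nonneg:
  assumes "\<And>i. i \<in> {1..n} \<Longrightarrow> T i \<ge> 1" "v \<in> carrier_vec d"
  shows "0 \<le> v \<bullet> (sigma_hat d n T x *\<^sub>v v)"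
  unfolding scalar_prod_sigma_hat[OF assms(2)]
  by (intro mult_nonneg_nonneg sum_nonneg bridge_scatter_nonneg(1)[OF assms]) (auto intro: sum_nonneg)

text \<open>A vanishing sum of nonnegative forms vanishes termwise. Invertibility of the estimator
  thereby becomes a question whether the interior deviations of all sequences span the
  space.\<close>

lemma scalar_prod_sigma_hat_eq_0:
  assumes "\<And>i. i \<in> {1..n} \<Longrightarrow> T i \<ge> 1" "0 < (\<Sum>i=1..n. T i - 1)" "v \<in> carrier_vec d"
    and "v \<bullet> (sigma_hat d n T x *\<^sub>v v) = 0" "i \<in> {1..n}"
  shows "transpose_mat (interior_points d (T i) (x i) - interior_means d (T i) (x i)) *\<^sub>v v = 0\<^sub>v (T i - 1)"
proof -
  have m: "(\<Sum>i=1..n. real (T i - 1)) \<noteq> 0"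
    using assms(2) by (metis less_irrefl of_nat_0_eq_iff of_nat_sum)
  then have "(\<Sum>i=1..n. v \<bullet> (bridge_scatter d (T i) (x i) *\<^sub>v v)) = 0"
    using assms(4) unfolding scalar_prod_sigma_hat[OF assms(3)] by simp
  then have "v \<bullet> (bridge_scatter d (T i) (x i) *\<^sub>v v) = 0"
    using bridge_scatter_nonneg(1)[OF assms(1) assms(3)] assms(5)
    by (subst (asm) sum_nonneg_eq_0_iff) auto
  then show ?thesis
    by (rule bridge_scatter_nonneg(2)[OF assms(1)[OF assms(5)] assms(3)])
qed


text \<open>If \<open>w = A v\<close> were nonzero, moving from \<open>v\<close> by a small negative
  multiple of \<open>w\<close> would make the form negative: its linear term is
  \<open>2 t (w \<bullet> w)\<close>.\<close>

lemma positive_semidefinite_kernel: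
  fixes A :: "real mat"
  assumes A: "A \<in> carrier_mat n n" "transpose_mat A = A"
    and psd: "\<And>v. v \<in> carrier_vec n \<Longrightarrow> 0 \<le> v \<bullet> (A *\<^sub>v v)"
    and v: "v \<in> carrier_vec n" "v \<bullet> (A *\<^sub>v v) = 0"
  shows "A *\<^sub>v v = 0\<^sub>v n"
proof (rule ccontr)
  assume nz: "A *\<^sub>v v \<noteq> 0\<^sub>v n"
  define w where "w = A *\<^sub>v v"
  have w: "w \<in> carrier_vec n" using A v by (simp add: w_def)
  have pos: "0 < w \<bullet> w"
    using scalar_prod_self_nonneg[of w] scalar_prod_self_eq_0[OF w] nz by (force simp: w_def)
  define q where "q = w \<bullet> (A *\<^sub>v w)"
  have q: "0 \<le> q" unfolding q_def by (rule psd[OF w])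
  have vAw: "v \<bullet> (A *\<^sub>v w) = w \<bullet> w"
    using transpose_vec_mult_scalar[OF A(1) w v(1)] by (simp add: A(2) w_def)
  have "0 \<le> (v + t \<cdot>\<^sub>v w) \<bullet> (A *\<^sub>v (v + t \<cdot>\<^sub>v w))" for t
    using v w by (intro psd) simp
  moreover have "(v + t \<cdot>\<^sub>v w) \<bullet> (A *\<^sub>v (v + t \<cdot>\<^sub>v w)) = 2 * t * (w \<bullet> w) + t * t * q" for t
  proof -
    have Aw: "A *\<^sub>v w \<in> carrier_vec n" using A w by simp
    have "A *\<^sub>v (v + t \<cdot>\<^sub>v w) = w + t \<cdot>\<^sub>v (A *\<^sub>v w)"
      using A(1) v(1) w by (simp add: mult_add_distrib_mat_vec[of _ n n] mult_mat_vec[of _ n n] w_def)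
    moreover have "v \<bullet> w = 0" using v(2) by (simp add: w_def)
    ultimately show ?thesis
      using v(1) w Aw
      by (simp add: add_scalar_prod_distrib[of _ n] scalar_prod_add_distrib[of _ n] vAw q_def algebra_simps)
  qed
  ultimately have *: "0 \<le> 2 * t * (w \<bullet> w) + t * t * q" for t by metis
  \<comment> \<open>The minimiser \<open>- (w \<bullet> w) / q\<close> of the quadratic polynomial,
    with \<open>q + 1\<close> for \<open>q\<close> so that \<open>q = 0\<close> is covered.\<close>
  have "0 \<le> 2 * (- (w \<bullet> w) / (q + 1)) * (w \<bullet> w) + (- (w \<bullet> w) / (q + 1)) * (- (w \<bullet> w) / (q + 1)) * q"
    by (rule *)
  also have "\<dots> = - ((w \<bullet> w) * (w \<bullet> w)) * (q + 2) / ((q + 1) * (q + 1))"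
    using q by (simp add: divide_simps) (simp add: algebra_simps)
  also have "\<dots> < 0"
    using pos q by (intro divide_neg_pos mult_neg_pos) auto
  finally show False by simp
qed

section \<open>Maximum likelihood estimates and invertibility of the estimator\<close>

lemma positive_definite_sigma_hat_iff:
  assumes "\<And>i. i \<in> {1..n} \<Longrightarrow> T i \<ge> 1"
  shows "positive_definite d (sigma_hat d n T x) \<longleftrightarrow> invertible_mat (sigma_hat d n T x)"
proof
  assume inv: "invertible_mat (sigma_hat d n T x)"
  note S = sigma_hat_carrier[of d n T x] sigma_hat_transpose[OF assms, where d = d and n = n and x = x]
  show "positive_definite d (sigma_hat d n T x)"
    unfolding positive_definite_def
  proof (intro conjI ballI impI S)
    fix v :: "real vec" assume v: "v \<in> carrier_vec d" "v \<noteq> 0\<^sub>v d"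
    have nonneg: "0 \<le> v \<bullet> (sigma_hat d n T x *\<^sub>v v)" if "v \<in> carrier_vec d" for v
      using scalar_prod_sigma_hat_nonneg[OF assms that] .
    have "sigma_hat d n T x *\<^sub>v v \<noteq> 0\<^sub>v d"
      using inv v invertible_mat_iff_kernel[OF S(1)] by blast
    then have "v \<bullet> (sigma_hat d n T x *\<^sub>v v) \<noteq> 0"
      using positive_semidefinite_kernel[OF S nonneg v(1)] by blast
    then show "0 < v \<bullet> (sigma_hat d n T x *\<^sub>v v)"
      using nonneg[OF v(1)] by simp
  qed
qed (rule positive_definite_invertible)

lemma is_mle_iff:
  assumes "\<And>i. i \<in> {1..n} \<Longrightarrow> T i \<ge> 1" "0 < (\<Sum>i=1..n. T i - 1)"
  shows "is_mle d n T x S \<longleftrightarrow> S = sigma_hat d n T x \<and> invertible_mat (sigma_hat d n T x)"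
proof -
  let ?A = "sigma_hat d n T x"
  define K where "K = 1 / 2 * (- real d * ln (2 * pi) * (\<Sum>i=1..n. real (T i - 1))
      - real d * (\<Sum>i=1..n. ln (Determinant.det (bridge_cov (T i)))))"
  define c where "c = 1 / 2 * (\<Sum>i=1..n. real (T i - 1))"
  have "0 < (\<Sum>i=1..n. real (T i - 1))"
    using assms(2) by (metis of_nat_0_less_iff of_nat_sum)
  then have c: "0 < c" by (simp add: c_def)
  have "log_likelihood d n T x S = K - c * stein_loss ?A S" if "S \<in> covariance_params d" for S
    unfolding K_def c_def by (rule log_likelihood_stein_loss[OF assms(2) _ that]) (rule assms(1))
  then have le: "log_likelihood d n T x S' \<le> log_likelihood d n T x S \<longleftrightarrow> stein_loss ?A S \<le> stein_loss ?A S'"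
    if "S \<in> covariance_params d" "S' \<in> covariance_params d" for S S'
    using c that by simp
  have mle: "is_mle d n T x S \<longleftrightarrow> S \<in> covariance_params d \<and>
      (\<forall>S'\<in>covariance_params d. stein_loss ?A S \<le> stein_loss ?A S')"
    unfolding is_mle_def using le by blast
  show ?thesis
  proof (cases "invertible_mat ?A")
    case True
    then have pd: "positive_definite d ?A"
      by (subst positive_definite_sigma_hat_iff) (use assms(1) in auto)
    then have mem: "?A \<in> covariance_params d" by (simp add: covariance_params_eq)
    \<comment> \<open>A minimiser and \<open>?A\<close> each have loss at most that of the other;
      the equality case then identifies them.\<close>
    show ?thesis
      unfolding mle using True stein_loss_minimum[OF pd] mem by (metis order_antisym)
  next
    case False
    then show ?thesis
      unfolding mle using stein_loss_no_minimum[OF sigma_hat_carrier False] by (meson not_le)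
  qed
qed

section \<open>Independence\<close>

text \<open>Independence only sees preimages inside \<open>space M\<close>, and the equation of the
  model holds only there.\<close>

lemma (in prob_space) indep_vars_cong_space:
  assumes "indep_vars M' X I" "\<And>i \<omega>. i \<in> I \<Longrightarrow> \<omega> \<in> space M \<Longrightarrow> X i \<omega> = Y i \<omega>"
  shows "indep_vars M' Y I"
proof -
  have vim: "X i -` A \<inter> space M = Y i -` A \<inter> space M" if "i \<in> I" for i A
    using assms(2)[OF that] by auto
  have "random_variable (M' i) (X i) \<longleftrightarrow> random_variable (M' i) (Y i)" if "i \<in> I" for i
    using assms(2)[OF that] by (rule measurable_cong)
  moreover have "indep_sets (\<lambda>i. {X i -` A \<inter> space M |A. A \<in> sets (M' i)}) I \<longleftrightarrow>
      indep_sets (\<lambda>i. {Y i -` A \<inter> space M |A. A \<in> sets (M' i)}) I"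
    by (rule indep_sets_cong) (auto simp: vim)
  ultimately show ?thesis
    using assms(1) unfolding indep_vars_def2 by blast
qed

text \<open>Fubini: the joint law is the product of the marginal laws, so the exceptional set is
  null once almost all its sections are. It replaces conditioning: \<open>X\<close> is frozen at one
  sample point while \<open>Y\<close> is drawn at another.\<close>

lemma (in prob_space) indep_var_AE:
  assumes indep: "indep_var S X N Y"
    and P: "{p \<in> space (S \<Otimes>\<^sub>M N). P p} \<in> sets (S \<Otimes>\<^sub>M N)"
    and ae: "AE \<omega> in M. AE \<omega>' in M. P (X \<omega>, Y \<omega>')"
  shows "AE \<omega> in M. P (X \<omega>, Y \<omega>)"
proof -
  have X: "random_variable S X" and Y: "random_variable N Y"
    and eq: "distr M S X \<Otimes>\<^sub>M distr M N Y = distr M (S \<Otimes>\<^sub>M N) (\<lambda>x. (X x, Y x))"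
    using indep unfolding indep_var_distribution_eq by auto
  interpret DY: prob_space "distr M N Y" by (rule prob_space_distr[OF Y])
  define Q where "Q = {p \<in> space (S \<Otimes>\<^sub>M N). \<not> P p}"
  have Q: "Q \<in> sets (S \<Otimes>\<^sub>M N)" unfolding Q_def using P by (rule sets.sets_Collect_neg)
  then have Q': "Q \<in> sets (distr M S X \<Otimes>\<^sub>M distr M N Y)" by (simp cong: sets_pair_measure_cong)
  have XY: "(\<lambda>\<omega>. (X \<omega>, Y \<omega>)) \<in> measurable M (S \<Otimes>\<^sub>M N)" using X Y by simp
  have "AE \<omega> in M. emeasure (distr M N Y) (Pair (X \<omega>) -` Q) = 0"
    using ae AE_space
  proof eventually_elim
    fix \<omega> assume \<omega>: "AE \<omega>' in M. P (X \<omega>, Y \<omega>')" "\<omega> \<in> space M"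
    have "Pair (X \<omega>) -` Q \<in> sets N" using Q by (rule sets_Pair1)
    then have "emeasure (distr M N Y) (Pair (X \<omega>) -` Q) = emeasure M (Y -` (Pair (X \<omega>) -` Q) \<inter> space M)"
      using Y by (simp add: emeasure_distr)
    also have "\<dots> = 0"
    proof -
      have eq: "Y -` (Pair (X \<omega>) -` Q) \<inter> space M = {\<omega>' \<in> space M. \<not> P (X \<omega>, Y \<omega>')}"
        using X Y \<omega>(2) by (auto simp: Q_def space_pair_measure dest: measurable_space)
      have "Y -` (Pair (X \<omega>) -` Q) \<inter> space M \<in> sets M"
        using \<open>Pair (X \<omega>) -` Q \<in> sets N\<close> Y by (rule measurable_sets[rotated])
      then show ?thesis
        using \<omega>(1) unfolding eq by (subst (asm) AE_iff_measurable[OF _ refl]) auto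
    qed
    finally show "emeasure (distr M N Y) (Pair (X \<omega>) -` Q) = 0" .
  qed
  moreover have "emeasure (distr M S X \<Otimes>\<^sub>M distr M N Y) Q =
      (\<integral>\<^sup>+\<omega>. emeasure (distr M N Y) (Pair (X \<omega>) -` Q) \<partial>M)"
    unfolding DY.emeasure_pair_measure_alt[OF Q']
    using Q' by (intro nn_integral_distr[OF X] DY.measurable_emeasure_Pair) (simp cong: sets_pair_measure_cong)
  ultimately have "emeasure (distr M S X \<Otimes>\<^sub>M distr M N Y) Q = 0"
    by (simp add: nn_integral_cong_AE)
  then have "emeasure M ((\<lambda>\<omega>. (X \<omega>, Y \<omega>)) -` Q \<inter> space M) = 0"
    unfolding eq using emeasure_distr[OF XY Q] by simp
  moreover have "{\<omega> \<in> space M. \<not> P (X \<omega>, Y \<omega>)} = (\<lambda>\<omega>. (X \<omega>, Y \<omega>)) -` Q \<inter> space M"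
    using measurable_space[OF XY] by (auto simp: Q_def)
  ultimately show ?thesis
    using measurable_sets[OF XY Q] by (intro AE_I[where N = "(\<lambda>\<omega>. (X \<omega>, Y \<omega>)) -` Q \<inter> space M"]) auto
qed

text \<open>Freeze the other summands: \<open>X i\<close> then has to avoid a single value, the one
  that cancels them.\<close>

lemma (in prob_space) indep_sum_nonatomic:
  fixes X :: "'i \<Rightarrow> 'a \<Rightarrow> real"
  assumes I: "finite I" "i \<notin> I" and indep: "indep_vars (\<lambda>_. borel) X (insert i I)"
    and nonatomic: "\<And>y. AE \<omega> in M. X i \<omega> \<noteq> y"
  shows "AE \<omega> in M. (\<Sum>j\<in>insert i I. X j \<omega>) \<noteq> 0"
proof -
  have "indep_var
    borel ((\<lambda>f. \<Sum>i\<in>I. f i) \<circ> (\<lambda>\<omega>. restrict (\<lambda>i. X i \<omega>) I))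
    borel ((\<lambda>f. f i) \<circ> (\<lambda>\<omega>. restrict (\<lambda>i. X i \<omega>) {i}))"
    using I by (intro indep_var_compose[OF indep_var_restrict[OF indep]]) auto
  then have "indep_var borel (\<lambda>\<omega>. \<Sum>j\<in>I. X j \<omega>) borel (X i)"
    by (simp add: comp_def)
  then have "AE \<omega> in M. (\<lambda>(a, b). a + b \<noteq> 0) (\<Sum>j\<in>I. X j \<omega>, X i \<omega>)"
  proof (rule indep_var_AE)
    show "AE \<omega> in M. AE \<omega>' in M. case (\<Sum>j\<in>I. X j \<omega>, X i \<omega>') of (a, b) \<Rightarrow> a + b \<noteq> 0"
    proof (rule AE_I2)
      fix \<omega>
      show "AE \<omega>' in M. case (\<Sum>j\<in>I. X j \<omega>, X i \<omega>') of (a, b) \<Rightarrow> a + b \<noteq> 0"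
        using nonatomic[of "- (\<Sum>j\<in>I. X j \<omega>)"] by eventually_elim auto
    qed
    have "(\<lambda>p. fst p + snd p \<noteq> (0::real)) \<in> measurable (borel \<Otimes>\<^sub>M borel) (count_space UNIV)"
      by measurable
    then show "{p \<in> space (borel \<Otimes>\<^sub>M borel). case p of (a, b) \<Rightarrow> a + b \<noteq> (0::real)} \<in> sets (borel \<Otimes>\<^sub>M borel)"
      by (simp add: case_prod_beta pred_def)
  qed
  then show ?thesis
    using I by (auto simp: add.commute)
qed

section \<open>Nondegenerate Brownian bridges\<close>

text \<open>A constant of mean zero has second moment zero, so the degenerate case is excluded and a
  density remains.\<close>

lemma normal_rv_nonatomic:
  assumes M: "prob_space M" and X: "normal_rv M X"
    and mean: "(\<integral>\<omega>. X \<omega> \<partial>M) = 0" and square: "(\<integral>\<omega>. (X \<omega>)\<^sup>2 \<partial>M) \<noteq> 0"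
  shows "AE \<omega> in M. X \<omega> \<noteq> y"
proof -
  interpret prob_space M by (rule M)
  have meas: "X \<in> borel_measurable M" using X by (simp add: normal_rv_def)
  consider m where "AE \<omega> in M. X \<omega> = m"
    | m \<sigma> where "0 < \<sigma>" "distributed M lborel X (normal_density m \<sigma>)"
    using X unfolding normal_rv_def by blast
  then show ?thesis
  proof cases
    case 1
    then have "(\<integral>\<omega>. X \<omega> \<partial>M) = (\<integral>\<omega>. m \<partial>M)"
      using meas by (intro integral_cong_AE) auto
    then have "m = 0" using mean by (simp add: prob_space)
    then have "AE \<omega> in M. (X \<omega>)\<^sup>2 = 0" using 1 by (auto elim: eventually_mono)
    then have "(\<integral>\<omega>. (X \<omega>)\<^sup>2 \<partial>M) = 0" by (rule integral_eq_zero_AE)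
    with square show ?thesis by simp
  next
    case 2
    have "AE x in density lborel (normal_density m \<sigma>). x \<noteq> y"
      using AE_lborel_singleton[of y] by (subst AE_density) (auto elim: eventually_mono)
    then have "AE x in distr M lborel X. x \<noteq> y"
      unfolding distributed_distr_eq_density[OF 2(2)] .
    then show ?thesis
      using meas by (intro AE_distrD[of X M lborel "\<lambda>x. x \<noteq> y"]) auto
  qed
qed

text \<open>The second moment of the form is the quadratic form of \<open>bridge_cov T\<close> at
  the coefficient vector, which is positive.\<close>

lemma brownian_bridge_nonatomic:
  assumes M: "prob_space M" and B: "standard_brownian_bridge M (real T) B"
    and c: "t\<^sub>0 \<in> {1..<T}" "c t\<^sub>0 \<noteq> 0"
  shows "AE \<omega> in M. (\<Sum>t\<in>{1..<T}. c t * B (real t) \<omega>) \<noteq> y"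
proof (rule normal_rv_nonatomic[OF M])
  interpret prob_space M by (rule M)
  define X where "X \<omega> = (\<Sum>t\<in>{1..<T}. c t * B (real t) \<omega>)" for \<omega>
  have T: "T \<ge> 1" using c by auto
  have gauss: "normal_rv M (\<lambda>\<omega>. \<Sum>t\<in>{1..<T}. c t * B (real t) \<omega>)" for c
  proof -
    have "normal_rv M (\<lambda>\<omega>. \<Sum>t\<in>F. c t * B t \<omega>)" if "finite F" "F \<subseteq> {0..real T}" for F c
      using B that unfolding standard_brownian_bridge_def gaussian_process_def by blast
    note normal = this
    \<comment> \<open>The process is indexed by real times: integer times are embedded by
      \<open>real\<close>, and the floor recovers the coefficient.\<close>
    have "normal_rv M (\<lambda>\<omega>. \<Sum>t\<in>real ` {1..<T}. c (nat \<lfloor>t\<rfloor>) * B t \<omega>)"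
      by (rule normal) auto
    then show ?thesis by (simp add: sum.reindex inj_on_def)
  qed
  show "normal_rv M (\<lambda>\<omega>. \<Sum>t\<in>{1..<T}. c t * B (real t) \<omega>)" by (rule gauss)
  have cov: "(\<integral>\<omega>. B (real s) \<omega> * B (real t) \<omega> \<partial>M) = bridge_cov T $$ (s - 1, t - 1)"
    and int: "integrable M (\<lambda>\<omega>. B (real s) \<omega> * B (real t) \<omega>)"
    if st: "s \<in> {1..<T}" "t \<in> {1..<T}" for s t
  proof -
    have le: "(\<integral>\<omega>. B (real s) \<omega> * B (real t) \<omega> \<partial>M) = real s * (real T - real t) / real T"
      if "s \<le> t" "t < T" for s t
      using that B unfolding standard_brownian_bridge_def by auto
    have "(\<integral>\<omega>. B (real s) \<omega> * B (real t) \<omega> \<partial>M) = real (min s t) * (real T - real (max s t)) / real T"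
    proof (cases "s \<le> t")
      case True
      then show ?thesis using le[of s t] st by simp
    next
      case False
      then show ?thesis using le[of t s] st by (simp add: mult.commute)
    qed
    moreover have "min (s - 1) (t - 1) + 1 = min s t" "max (s - 1) (t - 1) + 1 = max s t"
      using st by auto
    moreover have "s - 1 < T - 1" "t - 1 < T - 1" using st by auto
    ultimately show *: "(\<integral>\<omega>. B (real s) \<omega> * B (real t) \<omega> \<partial>M) = bridge_cov T $$ (s - 1, t - 1)"
      by (simp only: bridge_cov_def index_mat split Let_def)
    \<comment> \<open>The definition of the bridge prescribes integrals without mentioning
      integrability. A non-integrable function has integral 0, so the nonzero covariance at interior
      times supplies it.\<close>
    have "(\<integral>\<omega>. B (real s) \<omega> * B (real t) \<omega> \<partial>M) \<noteq> 0"
      using st \<open>(\<integral>\<omega>. B (real s) \<omega> * B (real t) \<omega> \<partial>M) = real (min s t) * (real T - real (max s t)) / real T\<close>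
      by (auto simp: min_def max_def)
    then show "integrable M (\<lambda>\<omega>. B (real s) \<omega> * B (real t) \<omega>)"
      using not_integrable_integral_eq by blast
  qed
  have meas: "B (real t) \<in> borel_measurable M" if "t \<in> {1..<T}" for t
  proof -
    have "(\<lambda>\<omega>. \<Sum>s\<in>{1..<T}. (if s = t then 1 else 0) * B (real s) \<omega>) \<in> borel_measurable M"
      using gauss by (simp add: normal_rv_def)
    also have "(\<lambda>\<omega>. \<Sum>s\<in>{1..<T}. (if s = t then 1 else 0) * B (real s) \<omega>) = B (real t)"
      using that by (auto simp: if_distrib[of "\<lambda>x. x * _"] sum.delta cong: if_cong)
    finally show ?thesis .
  qed
  have int1: "integrable M (B (real t))" if "t \<in> {1..<T}" for t
    using square_integrable_imp_integrable[OF meas[OF that]] int[OF that that]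
    by (simp add: power2_eq_square)
  have "(\<integral>\<omega>. (\<Sum>t\<in>{1..<T}. c t * B (real t) \<omega>) \<partial>M) = (\<Sum>t\<in>{1..<T}. c t * (\<integral>\<omega>. B (real t) \<omega> \<partial>M))"
    using int1 by (subst Bochner_Integration.integral_sum) auto
  also have "\<dots> = 0"
    using B unfolding standard_brownian_bridge_def by (intro sum.neutral) auto
  finally show "(\<integral>\<omega>. (\<Sum>t\<in>{1..<T}. c t * B (real t) \<omega>) \<partial>M) = 0" .
  have shift: "(\<Sum>i<T - 1. f i) = (\<Sum>s\<in>{1..<T}. f (s - 1))" for f :: "nat \<Rightarrow> real"
    by (rule sum.reindex_bij_witness[of _ "\<lambda>s. s - 1" Suc]) auto
  define v where "v = vec (T - 1) (\<lambda>j. c (Suc j))"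
  have v: "v \<in> carrier_vec (T - 1)" by (simp add: v_def)
  have "t\<^sub>0 - 1 < T - 1" "Suc (t\<^sub>0 - 1) = t\<^sub>0" using c(1) by auto
  then have "v $ (t\<^sub>0 - 1) \<noteq> 0\<^sub>v (T - 1) $ (t\<^sub>0 - 1)" using c(2) by (simp add: v_def)
  then have "v \<noteq> 0\<^sub>v (T - 1)" by metis
  then have "0 < v \<bullet> (bridge_cov T *\<^sub>v v)" by (rule bridge_cov_positive[OF T v])
  also have "\<dots> = (\<Sum>i<T - 1. \<Sum>j<T - 1. c (Suc i) * bridge_cov T $$ (i, j) * c (Suc j))"
    unfolding quadratic_form_sum[OF bridge_cov_carrier v] by (simp add: v_def)
  also have "\<dots> = (\<Sum>s\<in>{1..<T}. \<Sum>t\<in>{1..<T}. c s * bridge_cov T $$ (s - 1, t - 1) * c t)"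
    unfolding shift by (intro sum.cong refl) (use c(1) in simp)
  also have "\<dots> = (\<Sum>s\<in>{1..<T}. \<Sum>t\<in>{1..<T}. (\<integral>\<omega>. c s * c t * (B (real s) \<omega> * B (real t) \<omega>) \<partial>M))"
    by (intro sum.cong refl) (simp add: cov)
  also have "\<dots> = (\<integral>\<omega>. (\<Sum>s\<in>{1..<T}. \<Sum>t\<in>{1..<T}. c s * c t * (B (real s) \<omega> * B (real t) \<omega>)) \<partial>M)"
    using int by (subst Bochner_Integration.integral_sum)
      (auto intro!: sum.cong Bochner_Integration.integral_sum[symmetric] Bochner_Integration.integrable_sum)
  also have "\<dots> = (\<integral>\<omega>. (\<Sum>t\<in>{1..<T}. c t * B (real t) \<omega>)\<^sup>2 \<partial>M)"
    by (simp add: power2_eq_square sum_product algebra_simps)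
  finally show "(\<integral>\<omega>. (\<Sum>t\<in>{1..<T}. c t * B (real t) \<omega>)\<^sup>2 \<partial>M) \<noteq> 0" by simp
qed

section \<open>Almost sure invertibility\<close>

lemma borel_measurable_det:
  fixes f :: "'b \<Rightarrow> nat \<times> nat \<Rightarrow> real"
  assumes "\<And>i j. i < n \<Longrightarrow> j < n \<Longrightarrow> (\<lambda>x. f x (i, j)) \<in> borel_measurable M"
  shows "(\<lambda>x. Determinant.det (mat n n (f x))) \<in> borel_measurable M"
proof -
  have "(\<lambda>x. Determinant.det (mat n n (f x))) =
      (\<lambda>x. \<Sum>p | p permutes {0..<n}. signof p * (\<Prod>i = 0..<n. f x (i, p i)))"
    by (rule ext, subst det_def'[of _ n])
      (auto dest: permutes_in_image intro!: sum.cong prod.cong)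
  also have "\<dots> \<in> borel_measurable M"
    using assms
    by (intro borel_measurable_sum borel_measurable_times borel_measurable_prod borel_measurable_const)
      (auto dest: permutes_in_image)
  finally show ?thesis .
qed

text \<open>Induction over the leading principal minors: expanding along the last row gives a linear form
  in that row whose coefficients depend only on the previous rows, the last one being the previous
  minor.\<close>

lemma (in prob_space) AE_leading_minor_nonzero:
  fixes X :: "nat \<Rightarrow> nat \<Rightarrow> 'a \<Rightarrow> real"
  assumes indep: "indep_vars (\<lambda>_. Pi\<^sub>M {..<d} (\<lambda>_. borel)) (\<lambda>l \<omega>. \<lambda>p\<in>{..<d}. X l p \<omega>) {..<d}"
    and nondeg: "\<And>l c. l < d \<Longrightarrow> \<exists>p<d. c p \<noteq> 0 \<Longrightarrow> AE \<omega> in M. (\<Sum>p<d. c p * X l p \<omega>) \<noteq> 0"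
    and "k \<le> d"
  shows "AE \<omega> in M. Determinant.det (mat k k (\<lambda>(l, p). X l p \<omega>)) \<noteq> 0"
  using \<open>k \<le> d\<close>
proof (induction k)
  case 0
  show ?case by simp
next
  case (Suc k)
  then have k: "k < d" and IH: "AE \<omega> in M. Determinant.det (mat k k (\<lambda>(l, p). X l p \<omega>)) \<noteq> 0"
    by auto
  define R where "R = (\<lambda>l \<omega>. \<lambda>p\<in>{..<d}. X l p \<omega>)"
  \<comment> \<open>The earlier rows and row \<open>k\<close> are separate arguments, so that
    \<open>indep_var_AE\<close> can evaluate them at different sample points.\<close>
  define F :: "(nat \<Rightarrow> nat \<Rightarrow> real) \<times> (nat \<Rightarrow> nat \<Rightarrow> real) \<Rightarrow> real mat" where
    "F z = mat (Suc k) (Suc k) (\<lambda>(l, p). if l < k then fst z l p else snd z k p)" for z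
  let ?N = "\<lambda>K. Pi\<^sub>M K (\<lambda>_::nat. Pi\<^sub>M {..<d} (\<lambda>_::nat. borel :: real measure))"
  let ?U = "\<lambda>\<omega>. \<lambda>l\<in>{..<k}. R l \<omega>" and ?V = "\<lambda>\<omega>. \<lambda>l\<in>{k}. R l \<omega>"
  have "indep_var (?N {..<k}) ?U (?N {k}) ?V"
    using k indep unfolding R_def[symmetric] by (intro indep_var_restrict) auto
  then have "AE \<omega> in M. Determinant.det (F (?U \<omega>, ?V \<omega>)) \<noteq> 0"
  proof (rule indep_var_AE)
    have "(\<lambda>z. Determinant.det (F z)) \<in> borel_measurable (?N {..<k} \<Otimes>\<^sub>M ?N {k})"
      unfolding F_def
    proof (rule borel_measurable_det)
      fix i j assume ij: "i < Suc k" "j < Suc k"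
      have "(\<lambda>z. fst z i j) \<in> borel_measurable (?N {..<k} \<Otimes>\<^sub>M ?N {k})" if "i < k"
      proof -
        have "(\<lambda>z. fst z i) \<in> measurable (?N {..<k} \<Otimes>\<^sub>M ?N {k}) (Pi\<^sub>M {..<d} (\<lambda>_. borel))"
          using that by (intro measurable_compose[OF measurable_fst measurable_component_singleton]) auto
        from measurable_compose[OF this measurable_component_singleton] show ?thesis
          using ij k by simp
      qed
      moreover have "(\<lambda>z. snd z k j) \<in> borel_measurable (?N {..<k} \<Otimes>\<^sub>M ?N {k})"
      proof -
        have "(\<lambda>z. snd z k) \<in> measurable (?N {..<k} \<Otimes>\<^sub>M ?N {k}) (Pi\<^sub>M {..<d} (\<lambda>_. borel))"
          by (intro measurable_compose[OF measurable_snd measurable_component_singleton]) auto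
        from measurable_compose[OF this measurable_component_singleton] show ?thesis
          using ij k by simp
      qed
      ultimately show "(\<lambda>z. case (i, j) of (l, p) \<Rightarrow> if l < k then fst z l p else snd z k p)
          \<in> borel_measurable (?N {..<k} \<Otimes>\<^sub>M ?N {k})"
        by (cases "i < k") auto
    qed
    then show "{z \<in> space (?N {..<k} \<Otimes>\<^sub>M ?N {k}). Determinant.det (F z) \<noteq> 0}
        \<in> sets (?N {..<k} \<Otimes>\<^sub>M ?N {k})"
      by measurable
  next
    show "AE \<omega> in M. AE \<omega>' in M. Determinant.det (F (?U \<omega>, ?V \<omega>')) \<noteq> 0"
      using IH
    proof eventually_elim
      fix \<omega> assume minor: "Determinant.det (mat k k (\<lambda>(l, p). X l p \<omega>)) \<noteq> 0"
      \<comment> \<open>Only the cofactors of \<open>G\<close> along row \<open>k\<close> are used;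
        they do not see that row, hence depend on the earlier rows alone. They are padded by 0
        because \<open>nondeg\<close> speaks of all \<open>d\<close> columns.\<close>
      define G where "G = mat (Suc k) (Suc k) (\<lambda>(l, p). X l p \<omega>)"
      define c where "c p = (if p < Suc k then cofactor G k p else 0)" for p
      have "mat_delete G k k = mat k k (\<lambda>(l, p). X l p \<omega>)"
        by (rule eq_matI) (auto simp: G_def mat_delete_def)
      then have "c k \<noteq> 0" using minor by (simp add: c_def cofactor_def)
      then have "AE \<omega>' in M. (\<Sum>p<d. c p * X k p \<omega>') \<noteq> 0" using nondeg k by blast
      then show "AE \<omega>' in M. Determinant.det (F (?U \<omega>, ?V \<omega>')) \<noteq> 0"
      proof eventually_elim
        fix \<omega>' assume lin: "(\<Sum>p<d. c p * X k p \<omega>') \<noteq> 0"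
        have F: "F (?U \<omega>, ?V \<omega>') \<in> carrier_mat (Suc k) (Suc k)" by (simp add: F_def)
        have "Determinant.det (F (?U \<omega>, ?V \<omega>')) =
            (\<Sum>p<Suc k. F (?U \<omega>, ?V \<omega>') $$ (k, p) * cofactor (F (?U \<omega>, ?V \<omega>')) k p)"
          by (rule laplace_expansion_row[OF F]) simp
        also have "\<dots> = (\<Sum>p<Suc k. c p * X k p \<omega>')"
        proof (intro sum.cong refl)
          fix p assume p: "p \<in> {..<Suc k}"
          have "mat_delete (F (?U \<omega>, ?V \<omega>')) k p = mat_delete G k p"
            using k by (intro eq_matI) (auto simp: F_def G_def mat_delete_def R_def)
          then show "F (?U \<omega>, ?V \<omega>') $$ (k, p) * cofactor (F (?U \<omega>, ?V \<omega>')) k p = c p * X k p \<omega>'"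
            using p k by (simp add: c_def cofactor_def F_def R_def)
        qed
        also have "\<dots> = (\<Sum>p<d. c p * X k p \<omega>')"
          using k by (intro sum.mono_neutral_left) (auto simp: c_def)
        finally show "Determinant.det (F (?U \<omega>, ?V \<omega>')) \<noteq> 0" using lin by simp
      qed
    qed
  qed
  moreover have "F (?U \<omega>, ?V \<omega>) = mat (Suc k) (Suc k) (\<lambda>(l, p). X l p \<omega>)" for \<omega>
    using k by (intro eq_matI) (auto simp: F_def R_def less_Suc_eq)
  ultimately show ?case by simp
qed

text \<open>The probability of a rectangle factors in two stages: across \<open>i\<close> by
  \<open>outer\<close>, applied to boxes over \<open>K\<close>, then within each \<open>i\<close> by
  \<open>inner\<close>.\<close>

lemma (in prob_space) indep_vars_pairs:
  assumes fin: "finite I" "finite K"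
    and outer: "indep_vars (\<lambda>i. Pi\<^sub>M K (N i)) (\<lambda>i \<omega>. \<lambda>k\<in>K. X i k \<omega>) I"
    and inner: "\<And>i. i \<in> I \<Longrightarrow> indep_vars (N i) (X i) K"
  shows "indep_vars (\<lambda>(i, k). N i k) (\<lambda>(i, k). X i k) (I \<times> K)"
\<comment> \<open>An empty intersection would be \<open>UNIV\<close> instead of
  \<open>space M\<close>.\<close>
proof (cases "I \<times> K = {}")
  case True
  show ?thesis unfolding True by (simp add: indep_vars_def2 indep_sets_def)
next
  case False
  then have ne: "I \<noteq> {}" "K \<noteq> {}" by auto
  have rv: "random_variable (N i k) (X i k)" if "i \<in> I" "k \<in> K" for i k
    using inner[OF that(1)] that(2) by (simp add: indep_vars_def2)
  show ?thesis
  proof (subst indep_vars_finite[where E = "\<lambda>(i, k). sets (N i k)"])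
    show "\<forall>A\<in>\<Pi> j\<in>I \<times> K. case j of (i, k) \<Rightarrow> sets (N i k).
        prob (\<Inter>j\<in>I \<times> K. (case j of (i, k) \<Rightarrow> X i k) -` A j \<inter> space M) =
        (\<Prod>j\<in>I \<times> K. prob ((case j of (i, k) \<Rightarrow> X i k) -` A j \<inter> space M))"
    proof
      fix A assume "A \<in> (\<Pi> j\<in>I \<times> K. case j of (i, k) \<Rightarrow> sets (N i k))"
      then have A: "A (i, k) \<in> sets (N i k)" if "i \<in> I" "k \<in> K" for i k using that by auto
      let ?Y = "\<lambda>i \<omega>. \<lambda>k\<in>K. X i k \<omega>" and ?A = "\<lambda>i. Pi\<^sub>E K (\<lambda>k. A (i, k))"
      have Y: "?Y i -` ?A i \<inter> space M = (\<Inter>k\<in>K. X i k -` A (i, k) \<inter> space M)" if "i \<in> I" for i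
        using ne by (auto simp: PiE_iff)
      have "(\<Inter>j\<in>I \<times> K. (case j of (i, k) \<Rightarrow> X i k) -` A j \<inter> space M) =
          (\<Inter>i\<in>I. ?Y i -` ?A i \<inter> space M)"
        using ne by (auto simp: PiE_iff)
      also have "prob \<dots> = (\<Prod>i\<in>I. prob (?Y i -` ?A i \<inter> space M))"
        using A fin ne by (intro indep_varsD_finite[OF outer] sets_PiM_I_finite) auto
      also have "\<dots> = (\<Prod>i\<in>I. \<Prod>k\<in>K. prob (X i k -` A (i, k) \<inter> space M))"
      proof (intro prod.cong refl)
        fix i assume i: "i \<in> I"
        show "prob (?Y i -` ?A i \<inter> space M) = (\<Prod>k\<in>K. prob (X i k -` A (i, k) \<inter> space M))"
          unfolding Y[OF i] using A i fin ne by (intro indep_varsD_finite[OF inner]) auto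
      qed
      also have "\<dots> = (\<Prod>j\<in>I \<times> K. prob ((case j of (i, k) \<Rightarrow> X i k) -` A j \<inter> space M))"
        by (simp add: prod.cartesian_product case_prod_beta)
      finally show "prob (\<Inter>j\<in>I \<times> K. (case j of (i, k) \<Rightarrow> X i k) -` A j \<inter> space M) =
        (\<Prod>j\<in>I \<times> K. prob ((case j of (i, k) \<Rightarrow> X i k) -` A j \<inter> space M))" .
    qed
  qed (use False fin rv in \<open>auto simp: sets.sigma_sets_eq sets.Int_stable dest: sets.sets_into_space\<close>)
qed


section \<open>From the estimator to a determinant of bridge values\<close>

lemma bridge_mean_endpoints:
  assumes "T \<ge> 1" "a \<in> carrier_vec d" "b \<in> carrier_vec d"
  shows "bridge_mean T a b 0 = a" "bridge_mean T a b T = b"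
  using assms by (auto simp: bridge_mean_def intro!: eq_vecI)

lemma bridge_mean_carrier:
  assumes "a \<in> carrier_vec d" "b \<in> carrier_vec d"
  shows "bridge_mean T a b t \<in> carrier_vec d"
  using assms by (auto simp: bridge_mean_def)

text \<open>The deterministic half, with \<open>z\<close> for the vectors of bridge values. If
  \<open>v\<close> is in the kernel, \<open>W^T v\<close> is orthogonal to every interior
  \<open>z i t\<close>; \<open>d\<close> of these form a nonsingular matrix, so \<open>W^T v\<close>
  and then \<open>v\<close> vanish.\<close>

lemma invertible_sigma_hatI:
  fixes z :: "nat \<Rightarrow> nat \<Rightarrow> real vec"
  assumes T: "\<And>i. i \<in> {1..n} \<Longrightarrow> T i \<ge> 1" "0 < (\<Sum>i=1..n. T i - 1)"
    and W: "W \<in> carrier_mat d d" "invertible_mat W"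
    and ab: "\<And>i. i \<in> {1..n} \<Longrightarrow> a i \<in> carrier_vec d \<and> b i \<in> carrier_vec d"
    and z: "\<And>i t. i \<in> {1..n} \<Longrightarrow> t \<le> T i \<Longrightarrow> z i t \<in> carrier_vec d"
      "\<And>i. i \<in> {1..n} \<Longrightarrow> z i 0 = 0\<^sub>v d \<and> z i (T i) = 0\<^sub>v d"
    and x: "\<And>i t. i \<in> {1..n} \<Longrightarrow> t \<le> T i \<Longrightarrow> x i t = bridge_mean (T i) (a i) (b i) t + W *\<^sub>v z i t"
    and cols: "\<And>p. p < d \<Longrightarrow> col_seq p \<in> {1..n} \<and> col_time p \<in> {1..<T (col_seq p)}"
    and det: "Determinant.det (mat d d (\<lambda>(l, p). z (col_seq p) (col_time p) $ l)) \<noteq> 0"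
  shows "invertible_mat (sigma_hat d n T x)"
proof -
  have WT: "transpose_mat W \<in> carrier_mat d d" using W by simp
  have "v = 0\<^sub>v d" if v: "v \<in> carrier_vec d" "sigma_hat d n T x *\<^sub>v v = 0\<^sub>v d" for v
  proof -
    define u where "u = transpose_mat W *\<^sub>v v"
    have u: "u \<in> carrier_vec d" using WT v by (simp add: u_def)
    have form: "v \<bullet> (sigma_hat d n T x *\<^sub>v v) = 0" using v by simp
    have orth: "u \<bullet> z i t = 0" if i: "i \<in> {1..n}" and t: "t \<in> {1..<T i}" for i t
    proof -
      define X where "X = interior_points d (T i) (x i) - interior_means d (T i) (x i)"
      have X: "X \<in> carrier_mat d (T i - 1)" unfolding X_def by (rule interior_difference_carrier)
      \<comment> \<open>\<open>interior_means\<close> uses the observed end points; these are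
        \<open>a i\<close> and \<open>b i\<close> since \<open>z\<close> vanishes there.\<close>
      have ends: "x i 0 = a i" "x i (T i) = b i"
        using x[OF i, of 0] x[OF i, of "T i"] z(2)[OF i] mult_mat_zero_vec[OF W(1)] ab[OF i]
          bridge_mean_endpoints[OF T(1)[OF i], of "a i" d "b i"] by auto
      have Wz: "W *\<^sub>v z i t \<in> carrier_vec d" using W z(1)[OF i, of t] t by simp
      have mean: "bridge_mean (T i) (a i) (b i) t \<in> carrier_vec d"
        using ab[OF i] by (intro bridge_mean_carrier) auto
      have cancel: "m + w - m = w" if "m \<in> carrier_vec d" "w \<in> carrier_vec d" for m w :: "real vec"
        using that by (intro eq_vecI) auto
      have "col X (t - 1) = x i t - bridge_mean (T i) (a i) (b i) t"
        using t Wz mean ends x[OF i, of t]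
        by (intro eq_vecI) (auto simp: X_def interior_points_def interior_means_def mat_of_cols_index)
      also have "\<dots> = W *\<^sub>v z i t"
        using t by (simp add: x[OF i, of t] cancel[OF mean Wz])
      finally have colX: "col X (t - 1) = W *\<^sub>v z i t" .
      have "transpose_mat X *\<^sub>v v = 0\<^sub>v (T i - 1)"
        unfolding X_def by (rule scalar_prod_sigma_hat_eq_0[OF _ T(2) v(1) form i]) (rule T(1))
      moreover have t': "t - 1 < T i - 1" using t by auto
      ultimately have "(transpose_mat X *\<^sub>v v) $ (t - 1) = 0" by simp
      then have "(W *\<^sub>v z i t) \<bullet> v = 0"
        using X t' colX by simp
      then have "v \<bullet> (W *\<^sub>v z i t) = 0"
        using comm_scalar_prod[OF v(1) Wz] by simp
      then show ?thesis
        unfolding u_def using transpose_vec_mult_scalar[OF W(1) _ v(1)] z(1)[OF i, of t] t by simp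
    qed
    define Z where "Z = mat d d (\<lambda>(l, p). z (col_seq p) (col_time p) $ l)"
    have Z: "transpose_mat Z \<in> carrier_mat d d" by (simp add: Z_def)
    have "transpose_mat Z *\<^sub>v u = 0\<^sub>v d"
    proof (rule eq_vecI)
      fix p assume "p < dim_vec (0\<^sub>v d)"
      then have p: "p < d" by simp
      then have zp: "z (col_seq p) (col_time p) \<in> carrier_vec d"
        using cols[OF p] by (intro z(1)) auto
      have "col Z p = z (col_seq p) (col_time p)"
        using p zp by (intro eq_vecI) (auto simp: Z_def)
      then have "(transpose_mat Z *\<^sub>v u) $ p = z (col_seq p) (col_time p) \<bullet> u"
        using p by (simp add: Z_def)
      also have "\<dots> = u \<bullet> z (col_seq p) (col_time p)" by (rule comm_scalar_prod[OF zp u])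
      also have "\<dots> = 0" using cols[OF p] by (intro orth) auto
      finally show "(transpose_mat Z *\<^sub>v u) $ p = 0\<^sub>v d $ p" using p by simp
    qed (simp add: Z_def)
    moreover have "invertible_mat (transpose_mat Z)"
      using det invertible_mat_iff_det[OF Z] det_transpose[of Z d] by (simp add: Z_def)
    ultimately have "u = 0\<^sub>v d" using invertible_mat_iff_kernel[OF Z] u by blast
    then show "v = 0\<^sub>v d"
      using invertible_transpose[OF W] invertible_mat_iff_kernel[OF WT] v(1) by (auto simp: u_def)
  qed
  then show ?thesis using invertible_mat_iff_kernel[OF sigma_hat_carrier] by blast
qed

text \<open>Padding with zeros turns a form in selected columns into one over all pairs of a
  sequence and an interior time, which can be summed sequence by sequence.\<close>

lemma sum_extend_injective:
  fixes f :: "'b \<Rightarrow> real"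
  assumes "inj_on g {..<d}" "g ` {..<d} \<subseteq> A" "finite A"
  shows "(\<Sum>p<d. c p * f (g p)) = (\<Sum>j\<in>A. (if j \<in> g ` {..<d} then c (the_inv_into {..<d} g j) else 0) * f j)"
proof -
  have "(\<Sum>j\<in>A. (if j \<in> g ` {..<d} then c (the_inv_into {..<d} g j) else 0) * f j) =
      (\<Sum>j\<in>g ` {..<d}. c (the_inv_into {..<d} g j) * f j)"
    using assms by (intro sum.mono_neutral_cong_right) auto
  also have "\<dots> = (\<Sum>p<d. c p * f (g p))"
    using assms by (simp add: sum.reindex the_inv_into_f_f)
  finally show ?thesis ..
qed

lemma (in prob_space) AE_invertible_sigma_hat:
  fixes s :: "nat \<Rightarrow> nat \<Rightarrow> 'a \<Rightarrow> real vec"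
  assumes T: "\<And>i. i \<in> {1..n} \<Longrightarrow> T i \<ge> 1" "0 < (\<Sum>i=1..n. T i - 1)"
    and W: "W \<in> carrier_mat d d" "invertible_mat W"
    and ab: "\<And>i. i \<in> {1..n} \<Longrightarrow> a i \<in> carrier_vec d \<and> b i \<in> carrier_vec d"
    and model: "\<And>i. i \<in> {1..n} \<Longrightarrow> brownian_bridge_model M d (T i) W (a i) (b i) (s i)"
    and seqs: "indep_sequences M d T s {1..n}"
    and large: "d \<le> (\<Sum>i=1..n. T i - 1)"
  shows "AE \<omega> in M. invertible_mat (sigma_hat d n T (\<lambda>i t. s i t \<omega>))"
proof -
  from model have "\<forall>i\<in>{1..n}. \<exists>B. (\<forall>k<d. standard_brownian_bridge M (real (T i)) (B k)) \<and>
          indep_vars (\<lambda>k. Pi\<^sub>M {0..real (T i)} (\<lambda>_. borel))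
            (\<lambda>k \<omega>. \<lambda>t\<in>{0..real (T i)}. B k t \<omega>) {..<d} \<and>
          (\<forall>t\<le>T i. \<forall>\<omega>\<in>space M.
             s i t \<omega> = bridge_mean (T i) (a i) (b i) t + W *\<^sub>v vec d (\<lambda>k. B k (real t) \<omega>))"
    unfolding brownian_bridge_model_def by (intro ballI)
  from bchoice[OF this] obtain B where
    B: "\<And>i k. i \<in> {1..n} \<Longrightarrow> k < d \<Longrightarrow> standard_brownian_bridge M (real (T i)) (B i k)"
    and B_indep: "\<And>i. i \<in> {1..n} \<Longrightarrow> indep_vars (\<lambda>k. Pi\<^sub>M {0..real (T i)} (\<lambda>_. borel))
            (\<lambda>k \<omega>. \<lambda>t\<in>{0..real (T i)}. B i k t \<omega>) {..<d}"
    and s: "\<And>i t \<omega>. i \<in> {1..n} \<Longrightarrow> t \<le> T i \<Longrightarrow> \<omega> \<in> space M \<Longrightarrow>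
             s i t \<omega> = bridge_mean (T i) (a i) (b i) t + W *\<^sub>v vec d (\<lambda>k. B i k (real t) \<omega>)"
    by blast
  obtain P where P: "P \<in> carrier_mat d d" "W * P = 1\<^sub>m d" "P * W = 1\<^sub>m d"
    using invertible_mat_obtain_inverse[OF W] .
  define N where "N i = Pi\<^sub>M {1..<T i} (\<lambda>_::nat. borel :: real measure)" for i
  define Z where "Z i k \<omega> = (\<lambda>t\<in>{1..<T i}. B i k (real t) \<omega>)" for i k \<omega>
  have inner: "indep_vars (\<lambda>k. N i) (Z i) {..<d}" if i: "i \<in> {1..n}" for i
  proof -
    have "indep_vars (\<lambda>k. N i)
        (\<lambda>k \<omega>. (\<lambda>x. \<lambda>t\<in>{1..<T i}. x (real t)) (\<lambda>t\<in>{0..real (T i)}. B i k t \<omega>)) {..<d}"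
      unfolding N_def
    proof (rule indep_vars_compose2[OF B_indep[OF i], where Y = "\<lambda>_ x. \<lambda>t\<in>{1..<T i}. x (real t)"])
      show "(\<lambda>x. \<lambda>t\<in>{1..<T i}. x (real t)) \<in>
          measurable (Pi\<^sub>M {0..real (T i)} (\<lambda>_. borel)) (Pi\<^sub>M {1..<T i} (\<lambda>_. borel :: real measure))"
        by (intro measurable_restrict measurable_component_singleton) auto
    qed
    then show ?thesis
      by (rule indep_vars_cong_space) (auto simp: Z_def)
  qed
  \<comment> \<open>Independence across \<open>i\<close> is known for the sequences, not for the
    chosen bridges. Applying \<open>P\<close>, the inverse of \<open>W\<close>, expresses the
    bridges through the sequence and so transfers it.\<close>
  have recover: "B i k (real t) \<omega> = (\<Sum>j<d. P $$ (k, j) * (s i t \<omega> $ j - bridge_mean (T i) (a i) (b i) t $ j))"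
    if i: "i \<in> {1..n}" and "k < d" "t \<le> T i" "\<omega> \<in> space M" for i k t \<omega>
  proof -
    let ?z = "vec d (\<lambda>k. B i k (real t) \<omega>)"
    have mean: "bridge_mean (T i) (a i) (b i) t \<in> carrier_vec d"
      using ab[OF i] by (intro bridge_mean_carrier) auto
    have Wz: "W *\<^sub>v ?z \<in> carrier_vec d" using W by simp
    have "?z = P *\<^sub>v (W *\<^sub>v ?z)"
      using assoc_mult_mat_vec[OF P(1) W(1), of ?z] P(3) by simp
    then have "?z $ k = (P *\<^sub>v (W *\<^sub>v ?z)) $ k" by simp
    also have "\<dots> = (\<Sum>j<d. P $$ (k, j) * (W *\<^sub>v ?z) $ j)"
      using P(1) W(1) \<open>k < d\<close> by (simp add: scalar_prod_def lessThan_atLeast0)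
    also have "\<dots> = (\<Sum>j<d. P $$ (k, j) * (s i t \<omega> $ j - bridge_mean (T i) (a i) (b i) t $ j))"
      using s[OF that(1,3,4)] mean W(1) by (intro sum.cong refl) simp
    finally show ?thesis using \<open>k < d\<close> by simp
  qed
  have outer: "indep_vars (\<lambda>i. Pi\<^sub>M {..<d} (\<lambda>k. N i)) (\<lambda>i \<omega>. \<lambda>k\<in>{..<d}. Z i k \<omega>) {1..n}"
  proof -
    define Y where "Y i x = (\<lambda>k\<in>{..<d}. \<lambda>t\<in>{1..<T i}.
      \<Sum>j<d. P $$ (k, j) * (x (t, j) - bridge_mean (T i) (a i) (b i) t $ j))"
      for i and x :: "nat \<times> nat \<Rightarrow> real"
    have "indep_vars (\<lambda>i. Pi\<^sub>M {..<d} (\<lambda>k. N i))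
        (\<lambda>i \<omega>. Y i (\<lambda>(t, k)\<in>{0..T i} \<times> {..<d}. s i t \<omega> $ k)) {1..n}"
    proof (rule indep_vars_compose2[OF seqs[unfolded indep_sequences_def], where Y = Y])
      fix i assume "i \<in> {1..n}"
      show "Y i \<in> measurable (Pi\<^sub>M ({0..T i} \<times> {..<d}) (\<lambda>_. borel)) (Pi\<^sub>M {..<d} (\<lambda>k. N i))"
        unfolding Y_def N_def
        by (intro measurable_restrict borel_measurable_sum borel_measurable_times borel_measurable_diff
          borel_measurable_const measurable_component_singleton) auto
    qed
    then show ?thesis
      by (rule indep_vars_cong_space)
        (auto simp: Y_def Z_def recover fun_eq_iff restrict_def intro!: sum.cong)
  qed
  have joint: "indep_vars (\<lambda>(i, k). N i) (\<lambda>(i, k). Z i k) ({1..n} \<times> {..<d})"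
    by (rule indep_vars_pairs[OF _ _ outer inner]) auto
  \<comment> \<open>All pairs of a sequence and an interior time. There are enough of them to select
    \<open>d\<close> distinct ones; \<open>f p\<close> and \<open>h p\<close> are the sequence and
    the time of column \<open>p\<close>.\<close>
  define C where "C = (SIGMA i:{1..n}. {1..<T i})"
  have C: "finite C" "d \<le> card C"
    using large by (auto simp: C_def)
  obtain g where g: "inj_on g {..<d}" "g ` {..<d} \<subseteq> C"
    using card_le_inj[of "{..<d}" C] C by auto
  define f where "f = fst \<circ> g"
  define h where "h = snd \<circ> g"
  have g_eq: "g p = (f p, h p)" for p by (simp add: f_def h_def)
  have fh: "f p \<in> {1..n} \<and> h p \<in> {1..<T (f p)}" if "p < d" for p
  proof -
    have "g p \<in> C" using g(2) that by auto
    then show ?thesis by (simp add: C_def g_eq)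
  qed
  have "AE \<omega> in M. Determinant.det (mat d d (\<lambda>(l, p). B (f p) l (real (h p)) \<omega>)) \<noteq> 0"
  proof (rule AE_leading_minor_nonzero[of d])
    \<comment> \<open>Regrouping by coordinate: row \<open>l\<close> depends only on the pairs with
      second index \<open>l\<close>, although its entries may come from several sequences.\<close>
    have "indep_vars (\<lambda>l. Pi\<^sub>M ({1..n} \<times> {l}) (\<lambda>(i, k). N i))
        (\<lambda>l \<omega>. \<lambda>ik\<in>{1..n} \<times> {l}. (\<lambda>(i, k). Z i k) ik \<omega>) {..<d}"
      by (rule indep_vars_restrict[OF joint]) (auto simp: disjoint_family_on_def)
    then have "indep_vars (\<lambda>_. Pi\<^sub>M {..<d} (\<lambda>_. borel))
        (\<lambda>l \<omega>. (\<lambda>l x. \<lambda>p\<in>{..<d}. x (f p, l) (h p)) l (\<lambda>ik\<in>{1..n} \<times> {l}. (\<lambda>(i, k). Z i k) ik \<omega>)) {..<d}"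
    proof (rule indep_vars_compose2[where Y = "\<lambda>l x. \<lambda>p\<in>{..<d}. x (f p, l) (h p)"])
      fix l
      show "(\<lambda>x. \<lambda>p\<in>{..<d}. x (f p, l) (h p)) \<in>
          measurable (Pi\<^sub>M ({1..n} \<times> {l}) (\<lambda>(i, k). N i)) (Pi\<^sub>M {..<d} (\<lambda>_. borel :: real measure))"
      proof (rule measurable_restrict)
        fix p assume "p \<in> {..<d}"
        then have p: "f p \<in> {1..n}" "h p \<in> {1..<T (f p)}" using fh by auto
        have "(\<lambda>x. x (f p, l)) \<in> measurable (Pi\<^sub>M ({1..n} \<times> {l}) (\<lambda>(i, k). N i)) (N (f p))"
          using measurable_component_singleton[of "(f p, l)" "{1..n} \<times> {l}" "\<lambda>(i, k). N i"] p by simp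
        moreover have "(\<lambda>y. y (h p)) \<in> borel_measurable (N (f p))"
          unfolding N_def using p by (intro measurable_component_singleton)
        ultimately show "(\<lambda>x. x (f p, l) (h p)) \<in>
            borel_measurable (Pi\<^sub>M ({1..n} \<times> {l}) (\<lambda>(i, k). N i))"
          by (rule measurable_compose)
      qed
    qed
    then show "indep_vars (\<lambda>_. Pi\<^sub>M {..<d} (\<lambda>_. borel))
        (\<lambda>l \<omega>. \<lambda>p\<in>{..<d}. B (f p) l (real (h p)) \<omega>) {..<d}"
      by (rule indep_vars_cong_space) (use fh in \<open>auto simp: Z_def fun_eq_iff restrict_def\<close>)
  next
    fix l and c :: "nat \<Rightarrow> real"
    assume l: "l < d" and "\<exists>p<d. c p \<noteq> 0"
    then obtain p where p: "p < d" "c p \<noteq> 0" by blast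
    define e where "e j = (if j \<in> g ` {..<d} then c (the_inv_into {..<d} g j) else 0)" for j
    \<comment> \<open>The contribution of sequence \<open>i\<close> to the linear form.
      Contributions are independent over \<open>i\<close>, and a sequence holding a nonzero
      coefficient contributes a variable without atoms.\<close>
    define H where "H i \<omega> = (\<Sum>t\<in>{1..<T i}. e (i, t) * B i l (real t) \<omega>)" for i \<omega>
    have "indep_vars (\<lambda>_. borel) (\<lambda>i \<omega>. (\<lambda>i x. \<Sum>t\<in>{1..<T i}. e (i, t) * x l t) i (\<lambda>k\<in>{..<d}. Z i k \<omega>)) {1..n}"
    proof (rule indep_vars_compose2[OF outer, where Y = "\<lambda>i x. \<Sum>t\<in>{1..<T i}. e (i, t) * x l t"])
      fix i
      show "(\<lambda>x. \<Sum>t\<in>{1..<T i}. e (i, t) * x l t) \<in> borel_measurable (Pi\<^sub>M {..<d} (\<lambda>k. N i))"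
      proof (intro borel_measurable_sum borel_measurable_times borel_measurable_const)
        fix t assume t: "t \<in> {1..<T i}"
        have "(\<lambda>x. x l) \<in> measurable (Pi\<^sub>M {..<d} (\<lambda>k. N i)) (N i)"
          using l by (intro measurable_component_singleton) simp
        moreover have "(\<lambda>y. y t) \<in> borel_measurable (N i)"
          unfolding N_def using t by (intro measurable_component_singleton)
        ultimately show "(\<lambda>x. x l t) \<in> borel_measurable (Pi\<^sub>M {..<d} (\<lambda>k. N i))"
          by (rule measurable_compose)
      qed
    qed
    then have H_indep: "indep_vars (\<lambda>_. borel) H {1..n}"
      by (rule indep_vars_cong_space) (use l in \<open>auto simp: H_def Z_def intro!: sum.cong\<close>)
    have "e (g p) \<noteq> 0" using p g(1) by (simp add: e_def the_inv_into_f_f)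
    then have nonatomic: "AE \<omega> in M. H (f p) \<omega> \<noteq> y" for y
      unfolding H_def using fh[OF p(1)] B[of "f p" l] l
      by (intro brownian_bridge_nonatomic[where t\<^sub>0 = "h p", OF prob_space_axioms]) (auto simp: g_eq)
    have ins: "insert (f p) ({1..n} - {f p}) = {1..n}" using fh[OF p(1)] by auto
    have "AE \<omega> in M. (\<Sum>i\<in>insert (f p) ({1..n} - {f p}). H i \<omega>) \<noteq> 0"
    proof (rule indep_sum_nonatomic)
      show "AE \<omega> in M. H (f p) \<omega> \<noteq> y" for y by (rule nonatomic)
      show "indep_vars (\<lambda>_. borel) H (insert (f p) ({1..n} - {f p}))"
        unfolding ins by (rule H_indep)
    qed auto
    moreover have "(\<Sum>p<d. c p * B (f p) l (real (h p)) \<omega>) = (\<Sum>i\<in>{1..n}. H i \<omega>)" for \<omega>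
    proof -
      have "(\<Sum>p<d. c p * (case g p of (i, t) \<Rightarrow> B i l (real t) \<omega>)) =
          (\<Sum>j\<in>C. e j * (case j of (i, t) \<Rightarrow> B i l (real t) \<omega>))"
        unfolding e_def by (rule sum_extend_injective[OF g C(1)])
      also have "\<dots> = (\<Sum>i\<in>{1..n}. H i \<omega>)"
        unfolding H_def C_def by (subst sum.Sigma) (auto intro!: sum.cong)
      finally show ?thesis by (simp add: g_eq)
    qed
    ultimately show "AE \<omega> in M. (\<Sum>p<d. c p * B (f p) l (real (h p)) \<omega>) \<noteq> 0"
      by (simp only: ins)
  qed simp
  then show ?thesis
    using AE_space
  proof eventually_elim
    fix \<omega> assume det: "Determinant.det (mat d d (\<lambda>(l, p). B (f p) l (real (h p)) \<omega>)) \<noteq> 0"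
      and \<omega>: "\<omega> \<in> space M"
    show "invertible_mat (sigma_hat d n T (\<lambda>i t. s i t \<omega>))"
    proof (rule invertible_sigma_hatI[where z = "\<lambda>i t. vec d (\<lambda>k. B i k (real t) \<omega>)"
        and col_seq = f and col_time = h and a = a and b = b, OF T(1) T(2) W ab])
      show "vec d (\<lambda>k. B i k (real 0) \<omega>) = 0\<^sub>v d \<and> vec d (\<lambda>k. B i k (real (T i)) \<omega>) = 0\<^sub>v d"
        if "i \<in> {1..n}" for i
        using B[OF that] \<omega> by (auto simp: standard_brownian_bridge_def intro!: eq_vecI)
      have "mat d d (\<lambda>(l, p). vec d (\<lambda>k. B (f p) k (real (h p)) \<omega>) $ l) =
          mat d d (\<lambda>(l, p). B (f p) l (real (h p)) \<omega>)"
        by (rule eq_matI) auto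
      then show "Determinant.det (mat d d (\<lambda>(l, p). vec d (\<lambda>k. B (f p) k (real (h p)) \<omega>) $ l)) \<noteq> 0"
        using det by simp
    qed (use s \<omega> fh in auto)
  qed
qed

text \<open>A singular \<open>sigma_hat\<close> lies outside the parameter set, and then no
  maximiser exists. Deviations are \<open>W\<close> times bridge values and the rank of
  \<open>sigma_hat\<close> is at most the number of interior points; the conditions of the second
  part exclude these two systematic causes of singularity.\<close>

theorem proposition2:
  fixes M :: "'w measure"
    and d n :: nat
    and T :: "nat \<Rightarrow> nat"
    and W :: "real mat"
    and a b :: "nat \<Rightarrow> real vec"
    and s :: "nat \<Rightarrow> nat \<Rightarrow> 'w \<Rightarrow> real vec"
  assumes "prob_space M"
    and "d \<ge> 1"
    and "\<And>i. i \<in> {1..n} \<Longrightarrow> T i \<ge> 1"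
    and "(\<Sum>i=1..n. T i - 1) > 0"
    and "W \<in> carrier_mat d d"
    and "\<And>i. i \<in> {1..n} \<Longrightarrow> a i \<in> carrier_vec d \<and> b i \<in> carrier_vec d"
    and "\<And>i. i \<in> {1..n} \<Longrightarrow> brownian_bridge_model M d (T i) W (a i) (b i) (s i)"
    and "indep_sequences M d T s {1..n}"
  shows "(\<forall>\<omega>\<in>space M. \<forall>S. is_mle d n T (\<lambda>i t. s i t \<omega>) S \<longleftrightarrow>
            S = sigma_hat d n T (\<lambda>i t. s i t \<omega>) \<and> invertible_mat (sigma_hat d n T (\<lambda>i t. s i t \<omega>)))
       \<and> (invertible_mat W \<and> (\<Sum>i=1..n. T i - 1) \<ge> d \<longrightarrow>
            (AE \<omega> in M. is_mle d n T (\<lambda>i t. s i t \<omega>) (sigma_hat d n T (\<lambda>i t. s i t \<omega>))))"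
proof (intro conjI impI ballI allI)
  interpret prob_space M by (rule assms(1))
  have mle: "is_mle d n T x S \<longleftrightarrow> S = sigma_hat d n T x \<and> invertible_mat (sigma_hat d n T x)" for x S
    by (rule is_mle_iff[OF _ assms(4)]) (rule assms(3))
  then show "is_mle d n T (\<lambda>i t. s i t \<omega>) S \<longleftrightarrow>
      S = sigma_hat d n T (\<lambda>i t. s i t \<omega>) \<and> invertible_mat (sigma_hat d n T (\<lambda>i t. s i t \<omega>))" for \<omega> S .
  assume W: "invertible_mat W \<and> (\<Sum>i=1..n. T i - 1) \<ge> d"
  have "AE \<omega> in M. invertible_mat (sigma_hat d n T (\<lambda>i t. s i t \<omega>))"
    by (rule AE_invertible_sigma_hat[where a = a and b = b, OF _ assms(4,5) _ _ _ assms(8)])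
      (use W assms(3,6,7) in auto)
  then show "AE \<omega> in M. is_mle d n T (\<lambda>i t. s i t \<omega>) (sigma_hat d n T (\<lambda>i t. s i t \<omega>))"
    by (simp add: mle)
qed

end
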